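(* Fix a real number $a\geq 1/2$. Then, as $n\to\infty$, \[ R(C_{2\lfloor an\rfloor}, F_n)= \begin{cases} (2+2a+o(1))\,n & \text{if } 1/2\leq a<1,\\ (4a+o(1))\,n & \text{if } a\geq 1, \end{cases} \] that is, $R(C_{2\lfloor an\rfloor},F_n)/n \to 2+2a$ if $1/2\le a<1$ and $R(C_{2\lfloor an\rfloor},F_n)/n\to 4a$ if $a\ge 1$.
   Context: For graphs $F$ and $H$, the Ramsey number $R(F,H)$ is the smallest positive integer $N$ such that every red/blue coloring of the edges of the complete graph $K_N$ contains a red copy of $F$ or a blue copy of $H$. $C_m$ denotes the cycle on $m$ vertices. The fan $F_n$ is the graph on $2n+1$ vertices $v,v_1,\dots,v_{2n}$ consisting of the $n$ triangles $vv_{2i-1}v_{2i}$, $i=1,\dots,n$, all sharing the common vertex $v$ (i.e., edges $vv_j$ for all $j$ and $v_{2i-1}v_{2i}$ for all $i$). *)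

theory Defs
  imports "HOL-Analysis.Analysis" "HOL-Library.Ramsey"
begin

text \<open>A graph is a pair of a vertex set and a set of edges, each edge being a two-element set of
  vertices; \<^term>\<open>[V]\<^bsup>2\<^esup>\<close> is the edge set of the complete graph on \<^term>\<open>V\<close>.\<close>

type_synonym 'a ugraph = "'a set \<times> 'a set set"

definition simple_graph :: "'a ugraph \<Rightarrow> bool" where
  "simple_graph G \<longleftrightarrow> finite (fst G) \<and> snd G \<subseteq> [fst G]\<^bsup>2\<^esup>"

text \<open>Copies are not required to be induced.\<close>

definition contains_copy :: "'a ugraph \<Rightarrow> 'b ugraph \<Rightarrow> bool" where
  "contains_copy G H \<longleftrightarrow>
     (\<exists>f. inj_on f (fst H) \<and> f ` fst H \<subseteq> fst G \<and> (\<forall>e \<in> snd H. f ` e \<in> snd G))"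

datatype colour = Red | Blue

definition colour_graph :: "nat \<Rightarrow> (nat set \<Rightarrow> colour) \<Rightarrow> colour \<Rightarrow> nat ugraph" where
  "colour_graph N \<kappa> c = ({..<N}, {e \<in> [{..<N}]\<^bsup>2\<^esup>. \<kappa> e = c})"

definition ramsey_arrow :: "nat \<Rightarrow> 'a ugraph \<Rightarrow> 'b ugraph \<Rightarrow> bool" where
  "ramsey_arrow N F H \<longleftrightarrow>
     (\<forall>\<kappa>. contains_copy (colour_graph N \<kappa> Red) F \<or> contains_copy (colour_graph N \<kappa> Blue) H)"

definition ramsey_number :: "'a ugraph \<Rightarrow> 'b ugraph \<Rightarrow> nat" where
  "ramsey_number F H = (LEAST N. 0 < N \<and> ramsey_arrow N F H)"

text \<open>A cycle in the usual sense only for \<open>m \<ge> 3\<close>; for \<open>m = 2\<close> it is a single edge.\<close>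

definition cycle_graph :: "nat \<Rightarrow> nat ugraph" where
  "cycle_graph m = ({..<m}, {{i, Suc i mod m} | i. i < m})"

text \<open>Vertex \<open>0\<close> is the centre \<open>v\<close>, and vertex \<open>j > 0\<close> is \<open>v\<^sub>j\<close>.\<close>

definition fan_graph :: "nat \<Rightarrow> nat ugraph" where
  "fan_graph n =
     ({0..2 * n}, {{0, j} | j. j \<in> {1..2 * n}} \<union> {{2 * i - 1, 2 * i} | i. i \<in> {1..n}})"

lemma simple_graph_cycle: "2 \<le> m \<Longrightarrow> simple_graph (cycle_graph m)"
proof -
  assume m: "2 \<le> m"
  have "i \<noteq> Suc i mod m" if "i < m" for i
    using that m by (cases "Suc i = m") auto
  then show ?thesis
    using m by (auto simp: simple_graph_def cycle_graph_def nsets_def card_2_iff')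
qed

lemma simple_graph_fan: "simple_graph (fan_graph n)"
proof -
  have "{0, j} \<in> [{0..2 * n}]\<^bsup>2\<^esup>" if "j \<in> {1..2 * n}" for j
    using that by (auto simp: nsets_def)
  moreover have "{2 * i - 1, 2 * i} \<in> [{0..2 * n}]\<^bsup>2\<^esup>" if "i \<in> {1..n}" for i
  proof -
    have "2 * i - 1 \<noteq> 2 * i" using that by auto
    then show ?thesis using that by (auto simp: nsets_def)
  qed
  ultimately show ?thesis
    unfolding simple_graph_def fan_graph_def fst_conv snd_conv by blast
qed

lemma contains_copy_clique:
  assumes H: "simple_graph H" and K: "finite K" "card K = card (fst H)" "K \<subseteq> fst G"
    and E: "[K]\<^bsup>2\<^esup> \<subseteq> snd G"
  shows "contains_copy G H"
proof -
  have "finite (fst H)" using H by (simp add: simple_graph_def)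
  then obtain f where f: "bij_betw f (fst H) K"
    using K finite_same_card_bij by metis
  have "f ` e \<in> snd G" if "e \<in> snd H" for e
  proof -
    have e: "e \<subseteq> fst H" "finite e" "card e = 2"
      using that H by (auto simp: simple_graph_def nsets_def)
    then have "card (f ` e) = 2"
      using f by (metis bij_betw_def card_image inj_on_subset)
    then have "f ` e \<in> [K]\<^bsup>2\<^esup>"
      using e f by (auto simp: nsets_def bij_betw_def)
    then show ?thesis using E by blast
  qed
  then show ?thesis
    using f K(3) unfolding contains_copy_def bij_betw_def by blast
qed

text \<open>The minimum in \<^const>\<open>ramsey_number\<close> is attained, by Ramsey's theorem.\<close>

lemma ramsey_number_arrow:
  assumes F: "simple_graph F" and H: "simple_graph H"
  shows "0 < ramsey_number F H \<and> ramsey_arrow (ramsey_number F H) F H"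
proof -
  obtain r where r: "1 \<le> r"
    and R: "\<And>(V::nat set) E. finite V \<Longrightarrow> r \<le> card V \<Longrightarrow>
      \<exists>K \<subseteq> V. card K = card (fst F) \<and> clique K E \<or> card K = card (fst H) \<and> indep K E"
    using ramsey2[of "card (fst F)" "card (fst H)"] by blast
  have "ramsey_arrow r F H"
    unfolding ramsey_arrow_def
  proof
    fix \<kappa>
    obtain K where K: "K \<subseteq> {..<r}"
      and *: "card K = card (fst F) \<and> clique K {e. \<kappa> e = Red} \<or>
              card K = card (fst H) \<and> indep K {e. \<kappa> e = Red}"
      using R[of "{..<r}" "{e. \<kappa> e = Red}"] by auto
    have fin: "finite K" using K finite_subset by blast
    have K2: "[K]\<^bsup>2\<^esup> \<subseteq> [{..<r}]\<^bsup>2\<^esup>" using K by (rule nsets_mono)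
    from * show "contains_copy (colour_graph r \<kappa> Red) F \<or> contains_copy (colour_graph r \<kappa> Blue) H"
    proof
      assume a: "card K = card (fst F) \<and> clique K {e. \<kappa> e = Red}"
      then have "\<kappa> e = Red" if "e \<in> [K]\<^bsup>2\<^esup>" for e
        using that by (auto simp: clique_def elim!: nsets2_E)
      then have "contains_copy (colour_graph r \<kappa> Red) F"
        using a K K2 fin by (intro contains_copy_clique[OF F, of K]) (auto simp: colour_graph_def)
      then show ?thesis ..
    next
      assume a: "card K = card (fst H) \<and> indep K {e. \<kappa> e = Red}"
      then have "\<kappa> e = Blue" if "e \<in> [K]\<^bsup>2\<^esup>" for e
        using that by (cases "\<kappa> e") (auto simp: indep_def elim!: nsets2_E)
      then have "contains_copy (colour_graph r \<kappa> Blue) H"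
        using a K K2 fin by (intro contains_copy_clique[OF H, of K]) (auto simp: colour_graph_def)
      then show ?thesis ..
    qed
  qed
  with r have "0 < r \<and> ramsey_arrow r F H" by simp
  then show ?thesis
    unfolding ramsey_number_def by (rule LeastI)
qed

end

theory Submission
  imports Defs
begin

text \<open>
  Put \<open>m = \<lfloor>an\<rfloor>\<close>. The lower bounds come from disjoint red cliques with all other edges blue: two cliques
  of size \<open>2m - 1\<close>, or three cliques of sizes about \<open>2m\<close>, \<open>n\<close>, \<open>n\<close>.

  For the upper bound, take a colouring of slightly more than \<open>2m + 2 max(m, n)\<close> vertices without a
  red \<open>C\<^sub>2\<^sub>m\<close> and without a blue \<open>F\<^sub>n\<close>. A maximum blue matching in a blue neighbourhood has fewer than
  \<open>n\<close> edges; what it misses is a red clique, and augmentation shows that this clique together with one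
  end of each matching edge is almost red complete. As there is no red \<open>C\<^sub>2\<^sub>m\<close>, blue degrees are at most
  about \<open>max(2n + m, 2m + n)\<close>, so red degrees exceed \<open>m\<close> by a linear amount. Deleting a small linear
  number of vertices splits the red graph into boundedly many pieces that stay connected after any small
  linear number of deletions. In such a piece, bounded-size dominating sets can be linked by paths of one
  exact even length (a biclique adjusts the length; either the piece is bipartite up to few
  vertices, or paths of both parities exist). Removing these links and closing an initial segment of
  a path on \<open>2m\<close> vertices in the rest, which exists by Dirac's rotation argument, gives a red
  \<open>C\<^sub>2\<^sub>m\<close> unless the piece has at most about \<open>2m\<close> vertices. So there are at least three pieces, all
  edges between different pieces are blue, and a vertex of the smallest piece is the centre of a blue fan.
\<close>

section \<open>Robustly connected graphs\<close>

locale adjacency =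
  fixes E :: "'a \<Rightarrow> 'a \<Rightarrow> bool"
  assumes sym: "E u v \<Longrightarrow> E v u" and irrefl: "\<not> E u u"
begin

definition nbrs :: "'a set \<Rightarrow> 'a \<Rightarrow> 'a set" where
  "nbrs S v = {u \<in> S. E v u}"

definition is_path :: "'a set \<Rightarrow> 'a list \<Rightarrow> bool" where
  "is_path S p \<longleftrightarrow> p \<noteq> [] \<and> distinct p \<and> set p \<subseteq> S \<and> successively E p"

text \<open>A cycle is recorded as a path whose two ends are adjacent. For \<open>l = 2\<close> this
  is a single edge, in agreement with \<open>cycle_graph 2\<close>.\<close>

definition has_cycle :: "'a set \<Rightarrow> nat \<Rightarrow> bool" where
  "has_cycle S l \<longleftrightarrow> (\<exists>p. is_path S p \<and> length p = l \<and> E (last p) (hd p))"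

definition conn :: "'a set \<Rightarrow> bool" where
  "conn S \<longleftrightarrow> (\<forall>A \<subseteq> S. A \<noteq> {} \<and> A \<noteq> S \<longrightarrow> (\<exists>a\<in>A. \<exists>b\<in>S - A. E a b))"

text \<open>This is (k+1)-connectivity without a lower bound on the number of vertices:
  \<open>conn\<close> holds for the empty set and for singletons, so a clique is robust for every
  \<open>k\<close>.\<close>

definition robust :: "nat \<Rightarrow> 'a set \<Rightarrow> bool" where
  "robust k S \<longleftrightarrow> (\<forall>F \<subseteq> S. card F \<le> k \<longrightarrow> conn (S - F))"

text \<open>A proper two-colouring, so \<open>\<exists>c. colours c S\<close> says that the graph on
  \<open>S\<close> is bipartite.\<close>

definition colours :: "('a \<Rightarrow> bool) \<Rightarrow> 'a set \<Rightarrow> bool" where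
  "colours c S \<longleftrightarrow> (\<forall>u\<in>S. \<forall>v\<in>S. E u v \<longrightarrow> c u \<noteq> c v)"

lemma E_commute: "E u v \<longleftrightarrow> E v u"
  using sym by blast

lemma successively_flip [simp]: "successively (\<lambda>x y. E y x) p \<longleftrightarrow> successively E p"
proof -
  have "(\<lambda>x y. E y x) = E" by (intro ext) (rule E_commute)
  then show ?thesis by (rule arg_cong)
qed

lemma nbrs_mono: "S \<subseteq> T \<Longrightarrow> nbrs S v \<subseteq> nbrs T v"
  by (auto simp: nbrs_def)

lemma finite_nbrs: "finite S \<Longrightarrow> finite (nbrs S v)"
  by (simp add: nbrs_def)

lemma card_nbrs_Diff:
  assumes "finite F" "card (nbrs S v) \<ge> d + card F" "finite S"
  shows "card (nbrs (S - F) v) \<ge> d"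
proof -
  have "nbrs S v \<subseteq> nbrs (S - F) v \<union> F" by (auto simp: nbrs_def)
  then have "card (nbrs S v) \<le> card (nbrs (S - F) v \<union> F)"
    using assms by (intro card_mono) (auto simp: finite_nbrs)
  also have "\<dots> \<le> card (nbrs (S - F) v) + card F" by (rule card_Un_le)
  finally show ?thesis using assms by linarith
qed

lemma robust_Diff:
  assumes "robust k S" "finite S" "finite F" "card F + j \<le> k"
  shows "robust j (S - F)"
  unfolding robust_def
proof (intro allI impI)
  fix G assume G: "G \<subseteq> S - F" "card G \<le> j"
  have "card ((F \<inter> S) \<union> G) \<le> card (F \<inter> S) + card G" by (rule card_Un_le)
  also have "\<dots> \<le> card F + j"
    using G assms(3) by (intro add_mono card_mono) auto
  finally have "card ((F \<inter> S) \<union> G) \<le> k" using assms by linarith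
  moreover have "(F \<inter> S) \<union> G \<subseteq> S" using G by auto
  ultimately have "conn (S - ((F \<inter> S) \<union> G))" using assms(1) unfolding robust_def by blast
  moreover have "S - ((F \<inter> S) \<union> G) = S - F - G" by auto
  ultimately show "conn (S - F - G)" by simp
qed

lemma robust_mono: "robust k S \<Longrightarrow> j \<le> k \<Longrightarrow> robust j S"
  unfolding robust_def by (meson le_trans)

lemma robust_conn: "robust k S \<Longrightarrow> conn S"
  unfolding robust_def by (metis Diff_empty card.empty empty_subsetI le0)

lemma is_path_subset: "is_path S p \<Longrightarrow> S \<subseteq> T \<Longrightarrow> is_path T p"
  by (auto simp: is_path_def)

lemma is_path_rev: "is_path S p \<Longrightarrow> is_path S (rev p)"
  by (simp add: is_path_def)

lemma is_path_append:
  "is_path S p \<Longrightarrow> is_path S q \<Longrightarrow> set p \<inter> set q = {} \<Longrightarrow> E (last p) (hd q) \<Longrightarrow> is_path S (p @ q)"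
  by (auto simp: is_path_def successively_append_iff)

section \<open>Breadth-first balls, levels and short paths\<close>

primrec reach :: "'a set \<Rightarrow> 'a \<Rightarrow> nat \<Rightarrow> 'a set" where
  "reach S r 0 = {r}"
| "reach S r (Suc i) = reach S r i \<union> {v \<in> S. \<exists>u \<in> reach S r i. E u v}"

definition level :: "'a set \<Rightarrow> 'a \<Rightarrow> 'a \<Rightarrow> nat" where
  "level S r v = (LEAST i. v \<in> reach S r i)"

lemma reach_subset: "r \<in> S \<Longrightarrow> reach S r i \<subseteq> S"
  by (induction i) auto

lemma root_in_reach: "r \<in> reach S r i"
  by (induction i) auto

text \<open>Each layer up to \<open>i\<close> separates the ball before it from \<open>y\<close>, so
  by robustness it has at least \<open>k + 1\<close> vertices.\<close>

lemma card_reach: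
  assumes "finite S" "robust k S" "r \<in> S" "y \<in> S" "y \<notin> reach S r i"
  shows "card (reach S r i) \<ge> i * (k + 1) + 1"
  using assms(5)
proof (induction i)
  case 0
  then show ?case by simp
next
  case (Suc i)
  let ?R = "reach S r i" and ?F = "reach S r (Suc i) - reach S r i"
  have fin: "finite (reach S r j)" for j
    using reach_subset[OF assms(3)] assms(1) finite_subset by blast
  have "card ?F \<ge> k + 1"
  proof (rule ccontr)
    assume "\<not> k + 1 \<le> card ?F"
    then have "card ?F \<le> k" by simp
    moreover have "?F \<subseteq> S" using reach_subset[OF assms(3), of "Suc i"] by blast
    ultimately have "conn (S - ?F)"
      using assms(2) unfolding robust_def by blast
    moreover have "?R \<subseteq> S - ?F" "?R \<noteq> {}" "?R \<noteq> S - ?F"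
      using reach_subset[OF assms(3)] root_in_reach[of r S i] Suc.prems assms(4) by auto
    ultimately obtain a b where "a \<in> ?R" "b \<in> S - ?F - ?R" "E a b"
      unfolding conn_def by blast
    then show False by auto
  qed
  moreover have "card (reach S r (Suc i)) = card ?R + card ?F"
  proof -
    have "reach S r (Suc i) = ?R \<union> ?F" by auto
    then show ?thesis
      by (metis Diff_disjoint card_Un_disjoint fin finite_Diff)
  qed
  moreover have "y \<notin> ?R" using Suc.prems by auto
  ultimately show ?case using Suc.IH by simp
qed

text \<open>Layers of more than \<open>k\<close> vertices exhaust \<open>S\<close> within
  \<open>D\<close> steps. For \<open>k\<close> linear in \<open>card S\<close> the diameter is thus
  bounded by a constant.\<close>

lemma reach_eq:
  assumes "finite S" "robust k S" "r \<in> S" "card S \<le> k * D"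
  shows "reach S r D = S"
proof (rule antisym)
  show "reach S r D \<subseteq> S" by (rule reach_subset) fact
  show "S \<subseteq> reach S r D"
  proof
    fix y assume "y \<in> S"
    show "y \<in> reach S r D"
    proof (rule ccontr)
      assume "y \<notin> reach S r D"
      then have "D * (k + 1) + 1 \<le> card (reach S r D)"
        using card_reach assms \<open>y \<in> S\<close> by blast
      also have "\<dots> \<le> card S"
        using reach_subset assms by (intro card_mono) auto
      finally show False using assms(4) by (simp add: algebra_simps)
    qed
  qed
qed

lemma in_reach_level: "v \<in> reach S r i \<Longrightarrow> v \<in> reach S r (level S r v)"
  unfolding level_def by (rule LeastI)

lemma level_le: "v \<in> reach S r i \<Longrightarrow> level S r v \<le> i"
  unfolding level_def by (rule Least_le)

lemma level_edge:
  assumes "u \<in> reach S r i" "v \<in> S" "E u v"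
  shows "level S r v \<le> Suc (level S r u)"
proof -
  have "v \<in> reach S r (Suc (level S r u))"
    using in_reach_level[OF assms(1)] assms(2,3) by auto
  then show ?thesis by (rule level_le)
qed

text \<open>Tracing predecessors back gives a geodesic. The position of a vertex on such a path is
  its level, which allows \<open>lollipop\<close> to compare two of them.\<close>

lemma level_path:
  assumes "r \<in> S" "v \<in> reach S r j"
  shows "\<exists>p. is_path S p \<and> hd p = r \<and> last p = v \<and> map (level S r) p = [0..<Suc (level S r v)]"
  using assms(2)
proof (induction "level S r v" arbitrary: v j)
  case 0
  then have "v = r" using in_reach_level[of v S r j] by simp
  then show ?case using assms(1) 0 by (intro exI[of _ "[r]"]) (auto simp: is_path_def)
next
  case (Suc i)
  have v: "v \<in> reach S r (Suc i)" using in_reach_level[OF Suc.prems] Suc.hyps(2) by simp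
  have nv: "v \<notin> reach S r i" using level_le[of v S r i] Suc.hyps(2) by auto
  then obtain u where u: "u \<in> reach S r i" "E u v" "v \<in> S" using v by auto
  have "level S r u = i"
    using level_le[OF u(1)] level_edge[OF u(1,3,2)] Suc.hyps(2) by linarith
  then obtain p where p: "is_path S p" "hd p = r" "last p = u" "map (level S r) p = [0..<Suc i]"
    using Suc.hyps(1)[of u i] u(1) by auto
  have "v \<notin> set p"
  proof
    assume "v \<in> set p"
    then have "level S r v \<in> set [0..<Suc i]" using p(4) by (metis image_eqI set_map)
    then show False using Suc.hyps(2) by simp
  qed
  then have "is_path S (p @ [v])"
    using p u by (intro is_path_append) (auto simp: is_path_def)
  then show ?case
    using p Suc.hyps(2)[symmetric] by (intro exI[of _ "p @ [v]"]) (auto simp: is_path_def)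
qed

lemma robust_path:
  assumes "finite S" "robust k S" "card S \<le> k * D" "x \<in> S" "y \<in> S"
  shows "\<exists>p. is_path S p \<and> hd p = x \<and> last p = y \<and> length p \<le> D + 1"
proof -
  have "y \<in> reach S x D" using reach_eq assms by blast
  then obtain p where p: "is_path S p" "hd p = x" "last p = y"
      "map (level S x) p = [0..<Suc (level S x y)]"
    using level_path assms by blast
  have "length p = Suc (level S x y)"
    using p(4) by (metis length_map length_upt minus_nat.diff_0)
  also have "\<dots> \<le> D + 1" using level_le[OF \<open>y \<in> reach S x D\<close>] by simp
  finally show ?thesis using p by blast
qed

section \<open>Odd cycles and paths of either parity\<close>

text \<open>The colouring by the parity of the level fails on some edge \<open>uw\<close>; levels of
  adjacent vertices differ by at most one, so \<open>u\<close> and \<open>w\<close> have the same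
  level. Geodesics from \<open>r\<close> to both, cut at their last common vertex, close through
  \<open>uw\<close> to an odd cycle. The list \<open>c\<close> is that cycle without the vertex
  \<open>last t\<close>, hence of even length.\<close>

lemma lollipop:
  assumes "reach S r D = S" "r \<in> S" "\<And>c. \<not> colours c S"
  shows "\<exists>t c. is_path S t \<and> is_path S c \<and> hd t = r \<and> length t \<le> D + 1 \<and> length c \<le> 2 * D \<and>
    set t \<inter> set c = {} \<and> even (length c) \<and> E (last t) (hd c) \<and> E (last t) (last c)"
proof -
  let ?l = "level S r"
  obtain u w where uw: "u \<in> S" "w \<in> S" "E u w" "even (?l u) = even (?l w)"
    using assms(3)[of "\<lambda>v. even (?l v)"] unfolding colours_def by blast
  have "?l u \<le> Suc (?l w)" "?l w \<le> Suc (?l u)"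
    using level_edge assms(1) uw sym by blast+
  moreover have "j = i" if "i \<le> Suc j" "j \<le> Suc i" "even i = even j" for i j :: nat
    using that by presburger
  ultimately have eq: "?l w = ?l u" using uw(4) by blast
  define k where "k = ?l u"
  have "k \<le> D" using level_le[of u S r D] assms(1) uw(1) by (simp add: k_def)
  obtain p where p: "is_path S p" "hd p = r" "last p = u" "map ?l p = [0..<Suc k]"
    using level_path[OF assms(2), of u D] assms(1) uw(1) by (auto simp: k_def)
  obtain p' where p': "is_path S p'" "hd p' = r" "last p' = w" "map ?l p' = [0..<Suc k]"
    using level_path[OF assms(2), of w D] assms(1) uw(2) eq by (auto simp: k_def)
  have len: "length p = Suc k" "length p' = Suc k"
    using p(4) p'(4) by (metis length_map length_upt minus_nat.diff_0)+
  have lev: "?l (p ! i) = i" "?l (p' ! i) = i" if "i \<le> k" for i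
  proof -
    have "map ?l p ! i = i" "map ?l p' ! i = i"
      using that unfolding p(4) p'(4) by (simp_all del: upt_Suc)
    then show "?l (p ! i) = i" "?l (p' ! i) = i" using that len by simp_all
  qed
  \<comment> \<open>The last position at which the two geodesics agree; the stem ends there.\<close>
  define i where "i = Max {i. i \<le> k \<and> p ! i = p' ! i}"
  have ne: "p \<noteq> []" "p' \<noteq> []" using len by auto
  have fin: "finite {i. i \<le> k \<and> p ! i = p' ! i}" by simp
  have "0 \<in> {i. i \<le> k \<and> p ! i = p' ! i}" using p(2) p'(2) ne by (simp add: hd_conv_nth)
  then have i: "i \<le> k" "p ! i = p' ! i"
    using Max_in[OF fin] unfolding i_def by blast+
  have later: "p ! j \<noteq> p' ! j" if "i < j" "j \<le> k" for j
  proof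
    assume "p ! j = p' ! j"
    then have "j \<le> i" using Max_ge[OF fin, of j] that(2) unfolding i_def by simp
    then show False using that(1) by simp
  qed
  have "u \<noteq> w" using uw(3) irrefl by blast
  have lastnth: "p ! k = u" "p' ! k = w"
    using p(3) p'(3) ne len by (auto simp: last_conv_nth)
  then have "i < k" using i \<open>u \<noteq> w\<close> by (metis le_neq_implies_less)
  let ?t = "take (Suc i) p" and ?d = "drop (Suc i) p" and ?d' = "drop (Suc i) p'"
  let ?c = "?d @ rev ?d'"
  have sp: "distinct p" "distinct p'" "successively E p" "successively E p'" "set p \<subseteq> S" "set p' \<subseteq> S"
    using p(1) p'(1) by (auto simp: is_path_def)
  have s: "successively E (?t @ ?d)" "successively E (take (Suc i) p' @ ?d')"
    using sp(3,4) by simp_all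
  then have ss: "successively E ?t" "successively E ?d" "successively E ?d'"
    by (simp_all only: successively_append_iff)
  have dne: "?d \<noteq> []" "?d' \<noteq> []" "?t \<noteq> []" "take (Suc i) p' \<noteq> []" using len \<open>i < k\<close> by auto
  have lt: "last ?t = p ! i" "last (take (Suc i) p') = p ! i"
    using len \<open>i < k\<close> i ne by (auto simp: last_conv_nth)
  have e1: "E (last ?t) (hd ?d)"
    using s(1) dne by (simp only: successively_append_iff) blast
  have e2: "E (last ?t) (hd ?d')"
    using s(2) dne lt by (simp only: successively_append_iff) metis
  have pt: "is_path S ?t"
    using sp ss dne by (auto simp: is_path_def dest: in_set_takeD)
  have pd: "is_path S ?d" "is_path S ?d'"
    using sp ss dne by (auto simp: is_path_def dest: in_set_dropD)
  have lev_d: "\<exists>j. i < j \<and> j \<le> k \<and> x = p ! j" if xin: "x \<in> set ?d" for x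
  proof -
    obtain a where "a < length ?d" "x = ?d ! a" using xin by (metis in_set_conv_nth)
    then show ?thesis using len by (intro exI[of _ "Suc i + a"]) auto
  qed
  have lev_d': "\<exists>j. i < j \<and> j \<le> k \<and> x = p' ! j" if xin: "x \<in> set ?d'" for x
  proof -
    obtain a where "a < length ?d'" "x = ?d' ! a" using xin by (metis in_set_conv_nth)
    then show ?thesis using len by (intro exI[of _ "Suc i + a"]) auto
  qed
  have lev_t: "?l x \<le> i" if xin: "x \<in> set ?t" for x
  proof -
    obtain a where "a < length ?t" "x = ?t ! a" using xin by (metis in_set_conv_nth)
    then show ?thesis using len lev by auto
  qed
  \<comment> \<open>A vertex on both remainders would occupy the same position in both, by its
    level, against the choice of \<open>i\<close>.\<close>
  have disj: "set ?d \<inter> set (rev ?d') = {}"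
  proof -
    have False if x: "x \<in> set ?d" "x \<in> set ?d'" for x
    proof -
      obtain a where a: "i < a" "a \<le> k" "x = p ! a" using lev_d x by blast
      obtain b where b: "i < b" "b \<le> k" "x = p' ! b" using lev_d' x by blast
      have "a = b" using a b lev by metis
      then show False using later a b by blast
    qed
    then show ?thesis by auto
  qed
  have "last ?d = u" "hd (rev ?d') = w"
    using dne p(3) p'(3) by (auto simp: hd_rev)
  then have pc: "is_path S ?c"
    using pd disj uw(3) by (intro is_path_append is_path_rev) auto
  have disj2: "set ?t \<inter> set ?c = {}"
  proof -
    have False if x: "x \<in> set ?t" "x \<in> set ?d \<or> x \<in> set ?d'" for x
      using lev_t[OF x(1)] x(2) lev_d[of x] lev_d'[of x] lev by (metis linorder_not_le)
    then show ?thesis by auto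
  qed
  have "hd ?t = r" using p(2) by simp
  moreover have "length ?t \<le> D + 1" using len \<open>i < k\<close> \<open>k \<le> D\<close> by simp
  moreover have "length ?c \<le> 2 * D" "even (length ?c)" using len \<open>i < k\<close> \<open>k \<le> D\<close> by auto
  moreover have "E (last ?t) (hd ?c)" using e1 dne(1) by simp
  moreover have "E (last ?t) (last ?c)" using e2 dne(2) by (simp add: last_rev)
  ultimately show ?thesis using pt pc disj2 by blast
qed

text \<open>A path from \<open>x\<close> hits the odd cycle of a lollipop rooted at \<open>r\<close> away from its stem; the two
  ways around the cycle differ in parity.\<close>

lemma parity_path:
  assumes "finite S" "robust (2 * h) S" "card S \<le> h * D" "D + 1 \<le> h" "r \<in> S" "x \<in> S" "r \<noteq> x"
    and nonbip: "\<And>F c. F \<subseteq> S \<Longrightarrow> card F \<le> 1 \<Longrightarrow> \<not> colours c (S - F)"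
  shows "\<exists>q. is_path S q \<and> hd q = r \<and> last q = x \<and> length q \<le> 4 * D + 2 \<and> even (length q) = b"
proof -
  \<comment> \<open>Deleting \<open>x\<close> keeps the lollipop away from the target; below,
    deleting the stem keeps the path from \<open>x\<close> away from \<open>t\<close>.\<close>
  let ?S = "S - {x}"
  have h: "h \<ge> 1" using assms by linarith
  have rS: "robust h ?S" by (rule robust_Diff[OF assms(2,1)]) (use h in auto)
  have "card ?S \<le> card S" using assms(1) by (simp add: card_mono)
  then have "card ?S \<le> h * D" using assms(3) by linarith
  then have "reach ?S r D = ?S"
    using reach_eq[OF _ rS] assms by auto
  then obtain t c where tc: "is_path ?S t" "is_path ?S c" "hd t = r" "length t \<le> D + 1"
    "length c \<le> 2 * D" "set t \<inter> set c = {}" "even (length c)" "E (last t) (hd c)" "E (last t) (last c)"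
    using lollipop[of ?S r D] assms(5-7) nonbip[of "{x}"] by auto
  let ?T = "S - set t"
  have "card (set t) \<le> h" using tc(4) assms(4) card_length[of t] by linarith
  then have rT: "robust h ?T" by (intro robust_Diff[OF assms(2,1)]) auto
  have "card ?T \<le> card S" using assms(1) by (simp add: card_mono)
  then have cT: "card ?T \<le> h * D" using assms(3) by linarith
  have cne: "c \<noteq> []" "set c \<subseteq> ?S" "distinct c" "successively E c" using tc(2) by (auto simp: is_path_def)
  have tne: "t \<noteq> []" "set t \<subseteq> ?S" "distinct t" "successively E t" using tc(1) by (auto simp: is_path_def)
  have "x \<in> ?T" using tne(2) assms(6) by auto
  moreover have "hd c \<in> ?T" using cne(1,2) tc(6) hd_in_set by fastforce
  ultimately obtain s where s: "is_path ?T s" "hd s = x" "last s = hd c" "length s \<le> D + 1"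
    using robust_path[OF _ rT cT] assms(1) by blast
  have sne: "s \<noteq> []" "set s \<subseteq> ?T" "distinct s" "successively E s" using s(1) by (auto simp: is_path_def)
  have "\<exists>y\<in>set s. y \<in> set c"
    using s(3) sne(1) cne(1) by (metis hd_in_set last_in_set)
  \<comment> \<open>\<open>z\<close> is the first vertex of \<open>s\<close> on the cycle, so
    \<open>s1\<close> meets neither the cycle nor the stem.\<close>
  then obtain s1 z s2 where s12: "s = s1 @ z # s2" "z \<in> set c" "\<forall>y\<in>set s1. y \<notin> set c"
    using split_list_first_prop[of s "\<lambda>y. y \<in> set c"] by blast
  then obtain c1 c2 where c12: "c = c1 @ z # c2" by (metis split_list)
  let ?q1 = "t @ (c1 @ [z]) @ rev s1" and ?q2 = "t @ (rev c2 @ [z]) @ rev s1"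
  have ss: "successively E (rev s1)" "s1 \<noteq> [] \<Longrightarrow> E z (hd (rev s1))"
    using sne(4) unfolding s12(1) by (auto simp: successively_append_iff hd_rev sym)
  have sc: "successively E (c1 @ [z])" "successively E (rev c2 @ [z])"
    using cne(4) unfolding c12
    by (auto simp: successively_append_iff last_rev successively_Cons sym)
  have hc: "hd (c1 @ [z]) = hd c" "hd (rev c2 @ [z]) = last c"
    unfolding c12 by (cases c1; simp) (cases c2 rule: rev_cases; simp)
  have z: "z \<in> ?S" using s12(2) cne(2) by auto
  then have "s1 \<noteq> []" using s(2) unfolding s12(1) by auto
  then have hr: "last (rev s1) = x" using s(2) unfolding s12(1) by (cases s1) auto
  have "successively E (t @ A @ rev s1)"
    if "successively E A" "A \<noteq> []" "E (last t) (hd A)" "last A = z" for A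
    using that tne ss \<open>s1 \<noteq> []\<close> by (auto simp: successively_append_iff)
  from this[of "c1 @ [z]"] this[of "rev c2 @ [z]"]
  have suc: "successively E ?q1" "successively E ?q2"
    using sc tc(8,9) hc by auto
  have dis: "distinct ?q1" "distinct ?q2"
    using tne(3) cne(3) sne(2,3) tc(6) s12(2,3) unfolding c12 s12(1) by auto
  have sub: "set ?q1 \<subseteq> S" "set ?q2 \<subseteq> S"
    using tne(2) cne(2) sne(2) unfolding c12 s12(1) by auto
  have paths: "is_path S ?q1" "is_path S ?q2"
    using suc dis sub tne(1) by (auto simp: is_path_def)
  have ends: "hd ?q1 = r" "hd ?q2 = r" "last ?q1 = x" "last ?q2 = x"
    using tne(1) tc(3) hr \<open>s1 \<noteq> []\<close> by auto
  have lens: "length ?q1 \<le> 4 * D + 2" "length ?q2 \<le> 4 * D + 2"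
    using tc(4,5) s(4) unfolding c12 s12(1) by auto
  \<comment> \<open>\<open>c = c1 @ z # c2\<close> has even length, so \<open>c1\<close> and
    \<open>c2\<close> have lengths of different parity.\<close>
  have "even (length ?q1) \<noteq> even (length ?q2)"
    using tc(7) unfolding c12 by simp
  then show ?thesis using paths ends lens by blast
qed


section \<open>Long paths, bicliques and dominating sets\<close>

text \<open>Connectivity gives an edge \<open>ab\<close> leaving the cycle; the cycle is cut open at
  \<open>a\<close>, and \<open>b\<close> is put in front.\<close>

lemma path_extends_cycle:
  assumes "is_path S q" "E (last q) (hd q)" "conn S" "set q \<noteq> S"
  shows "\<exists>p. is_path S p \<and> length p = Suc (length q)"
proof -
  have q: "q \<noteq> []" "distinct q" "set q \<subseteq> S" "successively E q" using assms(1) by (auto simp: is_path_def)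
  then obtain a b where ab: "a \<in> set q" "b \<in> S - set q" "E a b"
    using assms(3,4) unfolding conn_def by (metis set_empty)
  then obtain q1 q2 where q12: "q = q1 @ a # q2" by (metis split_list)
  have "successively E (a # q2 @ q1)"
  proof (cases "q1 = []")
    case True
    then show ?thesis using q(4) q12 by simp
  next
    case False
    then have "E (last (a # q2)) (hd q1)" using assms(2) unfolding q12 by simp
    moreover have "successively E (a # q2)" "successively E q1"
      using q(4) unfolding q12 by (auto simp: successively_append_iff)
    ultimately have "successively E ((a # q2) @ q1)"
      using successively_append_iff by blast
    then show ?thesis by simp
  qed
  then have "is_path S (b # a # q2 @ q1)"
    using q ab sym unfolding is_path_def q12 by auto
  then show ?thesis using q12 by (intro exI[of _ "b # a # q2 @ q1"]) simp
qed

text \<open>All neighbours of both ends of a longest path lie on it. If it is shorter than claimed,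
  two crossing chords turn it into a cycle on the same vertices, and
  \<open>path_extends_cycle\<close> yields a longer path.\<close>

lemma dirac_path:
  assumes "finite S" "S \<noteq> {}" "conn S" and deg: "\<And>v. v \<in> S \<Longrightarrow> d \<le> card (nbrs S v)"
  shows "\<exists>p. is_path S p \<and> min (card S) (2 * d) \<le> length p"
proof -
  obtain x where "x \<in> S" using assms(2) by blast
  then have x: "is_path S [x]" by (auto simp: is_path_def)
  have bd: "length p \<le> card S" if "is_path S p" for p
  proof -
    have "set p \<subseteq> S" "length p = card (set p)"
      using that by (auto simp: is_path_def distinct_card)
    then show ?thesis using assms(1) by (simp add: card_mono)
  qed
  have "\<exists>p. is_path S p \<and> (\<forall>q. is_path S q \<longrightarrow> length q \<le> length p)"
    by (rule ex_has_greatest_nat[of "is_path S" "[x]" length "Suc (card S)"]) (use x bd in \<open>auto simp: less_Suc_eq_le\<close>)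
  then obtain p where p: "is_path S p" and pmax: "\<And>q. is_path S q \<Longrightarrow> length q \<le> length p"
    by blast
  have pp: "p \<noteq> []" "distinct p" "set p \<subseteq> S" "successively E p" using p by (auto simp: is_path_def)
  have "min (card S) (2 * d) \<le> length p"
  proof (rule ccontr)
    assume "\<not> ?thesis"
    then have lt: "length p < card S" "length p < 2 * d" by auto
    then have ne: "set p \<noteq> S" using pp(2) distinct_card by fastforce
    define M where "M = length p"
    have M: "M \<ge> 1" using pp(1) by (simp add: M_def Suc_leI)
    have hdn: "u \<in> set p" if "u \<in> nbrs S (hd p)" for u
    proof (rule ccontr)
      assume "u \<notin> set p"
      then have "is_path S (u # p)"
        using pp that sym by (auto simp: is_path_def nbrs_def successively_Cons)
      then show False using pmax by fastforce
    qed
    have lan: "u \<in> set p" if "u \<in> nbrs S (last p)" for u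
    proof (rule ccontr)
      assume "u \<notin> set p"
      then have "is_path S (p @ [u])"
        using pp that by (auto simp: is_path_def nbrs_def successively_append_iff)
      then show False using pmax by fastforce
    qed
    \<comment> \<open>Both sets index path edges from \<open>p ! i\<close> to
      \<open>p ! Suc i\<close>, and a common index gives crossing chords. There are only
      \<open>M - 1 < 2 * d\<close> indices, so two sets of size \<open>d\<close> must meet.\<close>
    define I1 where "I1 = {i. i < M - 1 \<and> E (hd p) (p ! Suc i)}"
    define I2 where "I2 = {i. i < M - 1 \<and> E (last p) (p ! i)}"
    have fin: "finite I1" "finite I2" by (auto simp: I1_def I2_def)
    have "nbrs S (hd p) \<subseteq> (\<lambda>i. p ! Suc i) ` I1"
    proof
      fix u assume u: "u \<in> nbrs S (hd p)"
      then obtain i where i: "i < M" "u = p ! i" using hdn by (metis M_def in_set_conv_nth)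
      have "i \<noteq> 0" using u i pp(1) irrefl[of "hd p"] by (cases i) (auto simp: nbrs_def hd_conv_nth)
      then obtain j where "i = Suc j" by (cases i) auto
      then show "u \<in> (\<lambda>i. p ! Suc i) ` I1" using i u by (auto simp: I1_def nbrs_def)
    qed
    then have "card (nbrs S (hd p)) \<le> card I1"
      using fin by (meson card_image_le card_mono finite_imageI le_trans)
    then have c1: "d \<le> card I1" using deg[of "hd p"] pp(1,3) hd_in_set by fastforce
    have "nbrs S (last p) \<subseteq> (\<lambda>i. p ! i) ` I2"
    proof
      fix u assume u: "u \<in> nbrs S (last p)"
      then obtain i where i: "i < M" "u = p ! i" using lan by (metis M_def in_set_conv_nth)
      have "i \<noteq> M - 1" using u i pp(1) irrefl by (auto simp: nbrs_def last_conv_nth M_def)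
      then show "u \<in> (\<lambda>i. p ! i) ` I2" using i u by (auto simp: I2_def nbrs_def)
    qed
    then have "card (nbrs S (last p)) \<le> card I2"
      using fin by (meson card_image_le card_mono finite_imageI le_trans)
    then have c2: "d \<le> card I2" using deg[of "last p"] pp(1,3) last_in_set by fastforce
    have "I1 \<inter> I2 \<noteq> {}"
    proof
      assume "I1 \<inter> I2 = {}"
      then have "card I1 + card I2 = card (I1 \<union> I2)" using fin by (simp add: card_Un_disjoint)
      also have "\<dots> \<le> card {..<M - 1}" by (intro card_mono) (auto simp: I1_def I2_def)
      finally show False using c1 c2 lt(2) M by (simp add: M_def)
    qed
    then obtain i where i: "i < M - 1" "E (hd p) (p ! Suc i)" "E (last p) (p ! i)"
      by (auto simp: I1_def I2_def)
    let ?a = "take (Suc i) p" and ?b = "drop (Suc i) p"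
    have ab: "?a \<noteq> []" "?b \<noteq> []" using i M_def by auto
    have "successively E (?a @ ?b)" using pp(4) by simp
    then have sab: "successively E ?a" "successively E ?b"
      by (simp_all only: successively_append_iff)
    have la: "last ?a = p ! i" using i pp(1) by (simp add: M_def last_conv_nth)
    have hb: "hd ?b = p ! Suc i" using i by (simp add: M_def hd_drop_conv_nth)
    have "distinct (?a @ ?b)" using pp(2) by simp
    then have "set ?a \<inter> set (rev ?b) = {}" unfolding distinct_append by simp
    moreover have "is_path S ?a" "is_path S ?b"
      using sab ab pp by (auto simp: is_path_def dest: in_set_takeD in_set_dropD)
    ultimately have "is_path S (?a @ rev ?b)"
      using ab i(3) la sym by (intro is_path_append is_path_rev) (auto simp: hd_rev)
    moreover have "E (last (?a @ rev ?b)) (hd (?a @ rev ?b))"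
      using ab i(2) hb sym pp(1) by (auto simp: last_rev)
    moreover have "set (?a @ rev ?b) = set p"
      by (metis append_take_drop_id set_append set_rev)
    ultimately obtain p' where "is_path S p'" "length p' = Suc (length (?a @ rev ?b))"
      using path_extends_cycle[of S "?a @ rev ?b"] assms(3) ne by auto
    then show False using pmax[of p'] by simp
  qed
  then show ?thesis using p by blast
qed

section \<open>Double counting: bicliques and dominating sets\<close>

lemma sum_card_nbrs:
  assumes "finite A" "finite B"
  shows "(\<Sum>a\<in>A. card (nbrs B a)) = (\<Sum>b\<in>B. card (nbrs A b))"
proof -
  have "card {a \<in> A. E a b} = card (nbrs A b)" for b
    unfolding nbrs_def using E_commute by (metis (no_types, lifting))
  then show ?thesis
    using sum_multicount_gen[OF assms, of E "\<lambda>b. card (nbrs A b)"] by (simp add: nbrs_def)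
qed

text \<open>The Kovari-Sos-Turan count. Vertices with fewer than \<open>s\<close> neighbours in
  \<open>X\<close> receive at most \<open>card S * s\<close> of the edges leaving \<open>X\<close>,
  so at least \<open>b * 2 ^ card X\<close> outside vertices have \<open>s\<close> or more. By
  pigeonhole, \<open>b\<close> of these have the same neighbourhood in \<open>X\<close>.\<close>

lemma biclique:
  assumes "finite S" "X \<subseteq> S" and deg: "\<And>v. v \<in> X \<Longrightarrow> d \<le> card (nbrs S v)"
    and big: "card X * card X + card S * s + card X * (b * 2 ^ card X) \<le> card X * d" and "card X > 0" "b > 0"
  shows "\<exists>Z Y. Z \<subseteq> X \<and> Y \<subseteq> S - X \<and> card Z = s \<and> b \<le> card Y \<and> (\<forall>z\<in>Z. \<forall>y\<in>Y. E z y)"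
proof -
  define q where "q = card X"
  have fX: "finite X" using assms finite_subset by blast
  define Y0 where "Y0 = {y \<in> S - X. s \<le> card (nbrs X y)}"
  have fY: "finite Y0" using assms(1) by (simp add: Y0_def)
  have "d \<le> card (nbrs (S - X) v) + q" if "v \<in> X" for v
  proof -
    have "nbrs S v \<subseteq> nbrs (S - X) v \<union> X" by (auto simp: nbrs_def)
    then have "card (nbrs S v) \<le> card (nbrs (S - X) v \<union> X)"
      using assms(1) fX by (intro card_mono) (auto simp: finite_nbrs)
    also have "\<dots> \<le> card (nbrs (S - X) v) + q" unfolding q_def by (rule card_Un_le)
    finally show ?thesis using deg[OF that] by linarith
  qed
  then have "(\<Sum>v\<in>X. d) \<le> (\<Sum>v\<in>X. card (nbrs (S - X) v) + q)" by (rule sum_mono)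
  then have "q * d \<le> (\<Sum>v\<in>X. card (nbrs (S - X) v)) + q * q" by (simp add: sum.distrib q_def)
  also have "(\<Sum>v\<in>X. card (nbrs (S - X) v)) = (\<Sum>y\<in>S - X. card (nbrs X y))"
    using sum_card_nbrs fX assms(1) by blast
  also have "\<dots> \<le> (\<Sum>y\<in>S - X. (if y \<in> Y0 then q else 0) + s)"
  proof (rule sum_mono)
    fix y assume "y \<in> S - X"
    moreover have "card (nbrs X y) \<le> q" unfolding q_def using fX by (intro card_mono) (auto simp: nbrs_def)
    ultimately show "card (nbrs X y) \<le> (if y \<in> Y0 then q else 0) + s"
      by (auto simp: Y0_def)
  qed
  also have "\<dots> = (\<Sum>y\<in>S - X. if y \<in> Y0 then q else 0) + card (S - X) * s" by (simp add: sum.distrib)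
  also have "(\<Sum>y\<in>S - X. if y \<in> Y0 then q else 0) = card Y0 * q"
  proof -
    have "(S - X) \<inter> Y0 = Y0" by (auto simp: Y0_def)
    then show ?thesis using assms(1) by (simp add: sum.inter_restrict[symmetric])
  qed
  also have "card (S - X) * s \<le> card S * s" using assms(1) by (simp add: card_mono)
  finally have "q * d \<le> card Y0 * q + card S * s + q * q" by simp
  then have "q * (b * 2 ^ q) \<le> q * card Y0" 
    using big unfolding q_def[symmetric] by (simp only: mult.commute[of q "card Y0"])
  then have large: "b * 2 ^ q \<le> card Y0" using assms(5) unfolding q_def by simp
  have "nbrs X \<in> Y0 \<rightarrow> Pow X" by (auto simp: nbrs_def)
  then obtain A where A: "A \<in> Pow X" "card Y0 \<le> card (nbrs X -` {A} \<inter> Y0) * card (Pow X)"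
    using pigeonhole_card[of "nbrs X" Y0 "Pow X"] fX fY by auto
  have "b * 2 ^ q \<le> card (nbrs X -` {A} \<inter> Y0) * 2 ^ q"
    using large A(2) unfolding card_Pow[OF fX] q_def by linarith
  then have b: "b \<le> card (nbrs X -` {A} \<inter> Y0)" by simp
  then have "nbrs X -` {A} \<inter> Y0 \<noteq> {}" using assms(6) by auto
  then have "s \<le> card A" by (auto simp: Y0_def)
  then obtain Z where Z: "Z \<subseteq> A" "card Z = s" by (meson obtain_subset_with_card_n)
  have "E z y" if "z \<in> Z" "y \<in> nbrs X -` {A} \<inter> Y0" for z y
    using that Z(1) sym by (auto simp: nbrs_def)
  moreover have "Z \<subseteq> X" using Z A by auto
  moreover have "nbrs X -` {A} \<inter> Y0 \<subseteq> S - X" by (auto simp: Y0_def)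
  ultimately show ?thesis using Z(2) b by blast
qed

text \<open>Greedy choice: some vertex of \<open>P\<close> dominates at least a \<open>1 / C\<close>
  share of what is still undominated. While more than \<open>u\<close> vertices are undominated,
  each round lowers \<open>C\<close> times their number by at least \<open>u\<close>.\<close>

lemma dominating_set:
  assumes "finite S" "finite P" "d > 0" "C > 0" "card P \<le> C * d"
    and deg: "\<And>v. v \<in> S \<Longrightarrow> d \<le> card (nbrs P v)"
  shows "\<exists>T \<subseteq> P. card T \<le> k \<and> (card {v \<in> S. nbrs T v = {}} \<le> u \<or>
     C * card {v \<in> S. nbrs T v = {}} + k * u \<le> C * card S)"
proof (induction k)
  case 0
  show ?case by (intro exI[of _ "{}"]) (auto simp: nbrs_def)
next
  case (Suc k)
  then obtain T where T: "T \<subseteq> P" "card T \<le> k" and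
    dis: "card {v \<in> S. nbrs T v = {}} \<le> u \<or> C * card {v \<in> S. nbrs T v = {}} + k * u \<le> C * card S"
    by blast
  let ?U = "{v \<in> S. nbrs T v = {}}"
  show ?case
  proof (cases "card ?U \<le> u")
    case True
    then show ?thesis using T by (intro exI[of _ T]) auto
  next
    case False
    then have dis: "C * card ?U + k * u \<le> C * card S" using dis by blast
    have fU: "finite ?U" using assms(1) by simp
    \<comment> \<open>If every \<open>t\<close> fell short, counting the edges between
      \<open>?U\<close> and \<open>P\<close> from both sides would contradict the degree bound
      \<open>d\<close>.\<close>
    have "\<exists>t\<in>P. card ?U \<le> C * card (nbrs ?U t)"
    proof (rule ccontr)
      assume "\<not> ?thesis"
      then have *: "C * card (nbrs ?U t) \<le> card ?U - 1" if "t \<in> P" for t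
        using that by fastforce
      have "d * card ?U = (\<Sum>v\<in>?U. d)" by simp
      also have "\<dots> \<le> (\<Sum>v\<in>?U. card (nbrs P v))" by (intro sum_mono) (use deg in auto)
      also have "\<dots> = (\<Sum>t\<in>P. card (nbrs ?U t))" using sum_card_nbrs fU assms(2) by blast
      finally have "C * (d * card ?U) \<le> (\<Sum>t\<in>P. C * card (nbrs ?U t))"
        using assms(4) by (simp add: sum_distrib_left[symmetric])
      also have "\<dots> \<le> (\<Sum>t\<in>P. card ?U - 1)" using * by (intro sum_mono) auto
      also have "\<dots> \<le> (C * d) * (card ?U - 1)" using assms(5) by simp
      also have "\<dots> < (C * d) * card ?U" using assms(3,4) False by simp
      finally show False by (simp add: mult.assoc)
    qed
    then obtain t where t: "t \<in> P" "card ?U \<le> C * card (nbrs ?U t)" by blast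
    have "{v \<in> S. nbrs (insert t T) v = {}} = ?U - nbrs ?U t"
      using sym by (auto simp: nbrs_def)
    then have "card {v \<in> S. nbrs (insert t T) v = {}} + card (nbrs ?U t) = card ?U"
    proof -
      have "nbrs ?U t \<subseteq> ?U" by (auto simp: nbrs_def)
      then have "card (?U - nbrs ?U t) + card (nbrs ?U t) = card ?U"
        using fU by (metis (no_types, lifting) card_Diff_subset card_mono finite_subset le_add_diff_inverse2)
      then show ?thesis using \<open>{v \<in> S. nbrs (insert t T) v = {}} = ?U - nbrs ?U t\<close> by metis
    qed
    then have "C * card {v \<in> S. nbrs (insert t T) v = {}} + C * card (nbrs ?U t) = C * card ?U"
      by (metis add_mult_distrib2)
    then have "C * card {v \<in> S. nbrs (insert t T) v = {}} + Suc k * u \<le> C * card S"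
      using t(2) dis False by simp
    moreover have "card (insert t T) \<le> Suc k"
      using T(2) card_insert_le_m1[of "Suc k" T t] by simp
    ultimately show ?thesis using T(1) t(1) by (intro exI[of _ "insert t T"]) auto
  qed
qed

section \<open>Links of one exact length\<close>

lemma zigzag:
  assumes "finite Y" "finite Z" "Y \<inter> Z = {}" "\<And>z y. z \<in> Z \<Longrightarrow> y \<in> Y \<Longrightarrow> E z y"
    "i < card Y" "i \<le> card Z"
  shows "\<exists>g. is_path (Y \<union> Z) g \<and> length g = 2 * i + 1 \<and> hd g \<in> Y \<and> last g \<in> Y"
  using assms
proof (induction i arbitrary: Y Z)
  case 0
  then obtain y where "y \<in> Y" by fastforce
  then show ?case by (intro exI[of _ "[y]"]) (auto simp: is_path_def)
next
  case (Suc i)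
  obtain y where y: "y \<in> Y" using Suc.prems(5) by fastforce
  obtain z where z: "z \<in> Z" using Suc.prems(6) by fastforce
  have "\<exists>g. is_path ((Y - {y}) \<union> (Z - {z})) g \<and> length g = 2 * i + 1 \<and> hd g \<in> Y - {y} \<and> last g \<in> Y - {y}"
    by (rule Suc.IH) (use Suc.prems y z in auto)
  then obtain g where g: "is_path ((Y - {y}) \<union> (Z - {z})) g" "length g = 2 * i + 1"
    "hd g \<in> Y - {y}" "last g \<in> Y - {y}" by blast
  have "is_path (Y \<union> Z) (y # z # g)"
    using g y z Suc.prems(3,4) sym by (auto simp: is_path_def successively_Cons)
  then show ?case using g y by (intro exI[of _ "y # z # g"]) (auto simp: is_path_def)
qed

lemma colours_path_parity:
  assumes "colours c S" "is_path S p"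
  shows "c (hd p) = c (last p) \<longleftrightarrow> odd (length p)"
  using assms(2)
proof (induction p rule: induct_list012)
  case (3 x y p)
  then have "is_path S (y # p)" "E x y" "x \<in> S" "y \<in> S" by (auto simp: is_path_def)
  then have "c (hd (y # p)) = c (last (y # p)) \<longleftrightarrow> odd (length (y # p))" "c x \<noteq> c y"
    using 3 assms(1) by (auto simp: colours_def)
  then show ?case by auto
qed (auto simp: is_path_def)

text \<open>The length of the link is adjusted in steps of two by zigzagging inside the biclique.\<close>

lemma exact_link:
  assumes "finite S" "robust (4 * h) S" "card S \<le> h * D" "7 * D + 10 \<le> h"
    and Z: "Z \<subseteq> S" "card Z = 6 * D + 8" and Y: "Y \<subseteq> S" "12 * D + 12 \<le> card Y" "Y \<inter> Z = {}"
    and ZY: "\<And>z y. z \<in> Z \<Longrightarrow> y \<in> Y \<Longrightarrow> E z y"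
    and t: "t \<in> S" "t' \<in> S" "t \<noteq> t'"
    and par: "(\<exists>c. colours c S \<and> c t \<noteq> c t') \<or> (\<forall>F c. F \<subseteq> S \<longrightarrow> card F \<le> 2 * h \<longrightarrow> \<not> colours c (S - F))"
  shows "\<exists>p. is_path S p \<and> hd p = t \<and> last p = t' \<and> length p = 6 * D + 4"
proof -
  have fin: "finite Z" "finite Y" using Z Y assms(1) finite_subset by blast+
  define Z1 where "Z1 = Z - {t, t'}"
  have "card Z \<le> card Z1 + card {t, t'}"
    unfolding Z1_def using fin by (metis diff_card_le_card_Diff finite.emptyI finite_insert le_diff_conv)
  then have cZ1: "6 * D + 6 \<le> card Z1" using Z t by simp
  have fZ1: "finite Z1" "Z1 \<subseteq> Z" using fin by (auto simp: Z1_def)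
  have cZ1': "card Z1 \<le> 6 * D + 8" using fZ1 fin Z(2) by (metis card_mono)
  obtain z1 where z1: "z1 \<in> Z1" using cZ1 by fastforce
  have "Z1 - {z1} \<noteq> {}"
  proof
    assume "Z1 - {z1} = {}"
    then have "card Z1 \<le> card {z1}" by (intro card_mono) auto
    then show False using cZ1 by simp
  qed
  then obtain z2 where z2: "z2 \<in> Z1" "z2 \<noteq> z1" by blast
  have card_rm: "card (Z1 - {z}) \<le> 6 * D + 8" for z
    using fZ1 cZ1' by (meson card_Diff1_le le_trans)
  \<comment> \<open>All of \<open>Z1\<close> except the target \<open>z1\<close> is blocked, so that
    \<open>p\<close> spends no vertex reserved for the zigzag; \<open>?F2\<close> does the same for
    \<open>q\<close> and \<open>z2\<close>.\<close>
  let ?F1 = "insert t' (Z1 - {z1})"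
  have "card ?F1 \<le> 6 * D + 9" using card_rm[of z1] fZ1 by (simp add: card_insert_if)
  then have r1: "robust h (S - ?F1)"
    using fZ1 assms(4) by (intro robust_Diff[OF assms(2,1)]) auto
  have le: "card (S - F) \<le> h * D" for F using assms(1,3) by (meson Diff_subset card_mono le_trans)
  have "t \<in> S - ?F1" "z1 \<in> S - ?F1" using t z1 Z(1) by (auto simp: Z1_def)
  then obtain p where p: "is_path (S - ?F1) p" "hd p = t" "last p = z1" "length p \<le> D + 1"
    using robust_path[OF _ r1 le] assms(1) by blast
  let ?F2 = "set p \<union> (Z1 - {z2})"
  have "card ?F2 \<le> card (set p) + card (Z1 - {z2})" by (rule card_Un_le)
  then have cF2: "card ?F2 \<le> 7 * D + 9" using card_rm[of z2] card_length[of p] p(4) by linarith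
  then have r2: "robust (2 * h) (S - ?F2)"
    using fZ1 assms(4) by (intro robust_Diff[OF assms(2,1)]) auto
  have "t' \<in> S - ?F2" "z2 \<in> S - ?F2" using t z2 p(1) Z(1) by (auto simp: Z1_def is_path_def)
  have "z2 \<noteq> t'" using z2 by (auto simp: Z1_def)
  have "\<exists>q. is_path (S - ?F2) q \<and> hd q = z2 \<and> last q = t' \<and> length q \<le> 4 * D + 2 \<and> odd (length p + length q)"
    using par
  proof
    assume "\<exists>c. colours c S \<and> c t \<noteq> c t'"
    then obtain c where c: "colours c S" "c t \<noteq> c t'" by blast
    have r2': "robust h (S - ?F2)" by (rule robust_mono[OF r2]) simp
    obtain q where q: "is_path (S - ?F2) q" "hd q = z2" "last q = t'" "length q \<le> D + 1"
      using robust_path[OF _ r2' le] assms(1) \<open>t' \<in> S - ?F2\<close> \<open>z2 \<in> S - ?F2\<close> by blast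
    have "is_path S p" "is_path S q" using p(1) q(1) is_path_subset by blast+
    then have pq: "c t = c z1 \<longleftrightarrow> odd (length p)" "c z2 = c t' \<longleftrightarrow> odd (length q)"
      using colours_path_parity[OF c(1)] p q by blast+
    \<comment> \<open>A common neighbour gives \<open>z1\<close> and \<open>z2\<close> the same
      colour. As \<open>t\<close> and \<open>t'\<close> differ in colour, the lengths of
      \<open>p\<close> and \<open>q\<close> have different parities.\<close>
    obtain y where "y \<in> Y" using Y(2) by fastforce
    then have "E z1 y" "E z2 y" "y \<in> S" "z1 \<in> S" "z2 \<in> S" using ZY z1 z2 fZ1 Y Z by auto
    then have "c z1 = c z2" using c(1) unfolding colours_def by blast
    then have "odd (length p + length q)" using pq c(2) by auto
    then show ?thesis using q by auto
  next
    assume nb: "\<forall>F c. F \<subseteq> S \<longrightarrow> card F \<le> 2 * h \<longrightarrow> \<not> colours c (S - F)"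
    have "\<not> colours c (S - ?F2 - F)" if F: "F \<subseteq> S - ?F2" "card F \<le> 1" for F c
    proof -
      have "card ((?F2 \<inter> S) \<union> F) \<le> card (?F2 \<inter> S) + card F" by (rule card_Un_le)
      also have "\<dots> \<le> card ?F2 + 1" using F fZ1 by (intro add_mono card_mono) auto
      also have "\<dots> \<le> 2 * h" using cF2 assms(4) by linarith
      finally have "card ((?F2 \<inter> S) \<union> F) \<le> 2 * h" .
      moreover have "(?F2 \<inter> S) \<union> F \<subseteq> S" using F(1) by auto
      ultimately have "\<not> colours c (S - ((?F2 \<inter> S) \<union> F))" using nb by simp
      moreover have "S - ((?F2 \<inter> S) \<union> F) = S - ?F2 - F" by auto
      ultimately show ?thesis by simp
    qed
    then obtain q where q: "is_path (S - ?F2) q" "hd q = z2" "last q = t'" "length q \<le> 4 * D + 2"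
       "even (length q) = odd (length p)"
      using parity_path[OF _ r2 le _ \<open>z2 \<in> S - ?F2\<close> \<open>t' \<in> S - ?F2\<close> \<open>z2 \<noteq> t'\<close>, of "odd (length p)"]
        assms(1,4) by auto
    then show ?thesis by auto
  qed
  then obtain q where q: "is_path (S - ?F2) q" "hd q = z2" "last q = t'" "length q \<le> 4 * D + 2"
    "odd (length p + length q)" by blast
  \<comment> \<open>The zigzag spends \<open>i\<close> vertices of \<open>Z\<close> and has
    \<open>2 * i + 1\<close> vertices. The total length of \<open>p\<close> and \<open>q\<close> is
    odd and at most \<open>5 * D + 3\<close>, so neither the division nor the subtraction loses
    anything.\<close>
  define i where "i = (6 * D + 3 - (length p + length q)) div 2"
  have "length p + length q \<le> 5 * D + 3" using p(4) q(4) by linarith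
  then have i: "length p + (2 * i + 1) + length q = 6 * D + 4" "i \<le> 3 * D + 2"
    using q(5) unfolding i_def by presburger+
  let ?Y = "Y - (set p \<union> set q)" and ?Z = "Z1 - {z1, z2}"
  have "card (set p \<union> set q) \<le> length p + length q"
    using card_Un_le[of "set p" "set q"] card_length[of p] card_length[of q] by linarith
  moreover have "card Y - card (set p \<union> set q) \<le> card ?Y" by (intro diff_card_le_card_Diff) auto
  ultimately have cY: "i < card ?Y" using Y(2) i(2) \<open>length p + length q \<le> 5 * D + 3\<close> by linarith
  have "card Z1 - card {z1, z2} \<le> card ?Z" by (intro diff_card_le_card_Diff) auto
  then have cZ: "i \<le> card ?Z" using cZ1 z2 i(2) by simp
  have "\<exists>g. is_path (?Y \<union> ?Z) g \<and> length g = 2 * i + 1 \<and> hd g \<in> ?Y \<and> last g \<in> ?Y"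
    by (rule zigzag[OF _ _ _ _ cY cZ]) (use fin fZ1 Y(3) ZY in auto)
  then obtain g where g: "is_path (?Y \<union> ?Z) g" "length g = 2 * i + 1" "hd g \<in> ?Y" "last g \<in> ?Y" by blast
  have "?Y \<union> ?Z \<subseteq> S" using Y(1) Z(1) fZ1 by blast
  then have P: "is_path S p" "is_path S q" "is_path S g"
    using p(1) q(1) g(1) is_path_subset by blast+
  have gq: "is_path S (g @ q)"
  proof (rule is_path_append[OF P(3,2)])
    show "set g \<inter> set q = {}" using g(1) q(1) by (fastforce simp: is_path_def)
    show "E (last g) (hd q)" using g(4) q(2) ZY[of z2 "last g"] z2 fZ1 sym by auto
  qed
  have "is_path S (p @ g @ q)"
  proof (rule is_path_append[OF P(1) gq])
    show "set p \<inter> set (g @ q) = {}" using g(1) p(1) q(1) by (fastforce simp: is_path_def)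
    show "E (last p) (hd (g @ q))" using g(1,3) p(3) ZY[of z1 "hd g"] z1 fZ1 by (auto simp: is_path_def)
  qed
  moreover have "hd (p @ g @ q) = t" "last (p @ g @ q) = t'"
    using p q by (auto simp: is_path_def)
  moreover have "length (p @ g @ q) = 6 * D + 4" using i(1) g(2) by simp
  ultimately show ?thesis by blast
qed

end

section \<open>Cycles of exact even length\<close>

text \<open>The length that \<open>exact_link\<close> produces for \<open>D = K\<close>: even, and
  dependent on \<open>K\<close> only.\<close>

definition link_len :: "nat \<Rightarrow> nat" where
  "link_len K = 6 * K + 4"

text \<open>The three summands are demands on \<open>h\<close>: the slack in
  \<open>exact_link\<close> for \<open>D = K\<close>, the count in \<open>biclique\<close> for a set
  of \<open>K * (6 * K + 8)\<close> vertices, and the size of two dominating sets together with one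
  link for each pair between them.\<close>

definition big_enough :: "nat \<Rightarrow> nat" where
  "big_enough K = 7 * K + 10 + (K * (6 * K + 8) + (12 * K + 12) * 2 ^ (K * (6 * K + 8))) +
     (2 * (K * K + 1) + (K * K + 1) * (K * K + 1) * link_len K)"

context adjacency begin

text \<open>After \<open>K * K + 1\<close> rounds the second alternative of
  \<open>dominating_set\<close> would force
  \<open>(K * K + 1) * h \<le> K * card S \<le> K * K * h\<close>.\<close>

lemma dominating_set_const:
  assumes "finite S" "card S \<le> K * h" "K > 0" "h > 0" "P \<subseteq> S"
    and deg: "\<And>v. v \<in> S \<Longrightarrow> h \<le> card (nbrs P v)"
  shows "\<exists>T \<subseteq> P. card T \<le> K * K + 1 \<and> card {v \<in> S. nbrs T v = {}} \<le> h"
proof -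
  have "finite P" using assms finite_subset by blast
  moreover have "card P \<le> K * h" using assms by (meson card_mono le_trans)
  ultimately have "\<exists>T \<subseteq> P. card T \<le> K * K + 1 \<and> (card {v \<in> S. nbrs T v = {}} \<le> h \<or>
     K * card {v \<in> S. nbrs T v = {}} + (K * K + 1) * h \<le> K * card S)"
    using assms by (intro dominating_set) auto
  moreover have "\<not> K * x + (K * K + 1) * h \<le> K * card S" for x
  proof -
    have "K * card S \<le> K * (K * h)" using assms(2) by simp
    also have "\<dots> < (K * K + 1) * h" using assms(4) by (simp add: algebra_simps)
    finally show ?thesis by linarith
  qed
  ultimately show ?thesis by simp
qed

text \<open>A bounded number of links between two bounded dominating sets is removed before a long path
  is chosen, so that any two path vertices at the right distance along it can be joined outside it.\<close>

lemma robust_even_cycle_aux: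
  assumes "finite S" "card S \<le> K * h" "K > 0" "big_enough K \<le> h" "robust (4 * h) S" "h \<le> m"
    and deg: "\<And>v. v \<in> S \<Longrightarrow> m + 3 * h \<le> card (nbrs S v)" and card: "2 * m + 3 * h \<le> card S"
    and par: "(\<exists>c. colours c S) \<or> (\<forall>F c. F \<subseteq> S \<longrightarrow> card F \<le> 2 * h \<longrightarrow> \<not> colours c (S - F))"
  shows "has_cycle S (2 * m)"
proof -
  define L where "L = link_len K"
  define k where "k = K * K + 1"
  \<comment> \<open>This size of \<open>X\<close> gives
    \<open>card S * (6 * K + 8) \<le> q * h\<close>, a term that \<open>biclique\<close> with
    \<open>s = 6 * K + 8\<close> can afford.\<close>
  define q where "q = K * (6 * K + 8)"
  have h: "7 * K + 10 \<le> h" "q + (12 * K + 12) * 2 ^ q \<le> h" "2 * k + k * k * L \<le> h" "L \<le> h" "0 < h"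
    "even L" "0 < L" "k \<le> h"
    using assms(4) unfolding big_enough_def q_def k_def L_def link_len_def by auto
  obtain X where X: "X \<subseteq> S" "card X = q"
  proof -
    have "q \<le> card S" using h(2) card by linarith
    then show ?thesis using that by (meson obtain_subset_with_card_n)
  qed
  have bi: "card X * card X + card S * (6 * K + 8) + card X * ((12 * K + 12) * 2 ^ card X)
      \<le> card X * (m + 3 * h)"
  proof -
    have "card S * (6 * K + 8) \<le> (K * h) * (6 * K + 8)" using assms(2) by (rule mult_le_mono1)
    also have "\<dots> = q * h" by (simp add: q_def algebra_simps)
    finally have "q * q + card S * (6 * K + 8) + q * ((12 * K + 12) * 2 ^ q)
      \<le> q * h + q * (q + (12 * K + 12) * 2 ^ q)" by (simp add: algebra_simps)
    also have "\<dots> \<le> q * h + q * h" using h(2) by simp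
    also have "\<dots> \<le> q * (m + 3 * h)" by (simp add: algebra_simps)
    finally show ?thesis using X by simp
  qed
  have "card X > 0" using X assms(3) by (simp add: q_def)
  moreover have "m + 3 * h \<le> card (nbrs S v)" if "v \<in> X" for v using that deg X(1) by blast
  ultimately obtain Z Y where ZY: "Z \<subseteq> X" "Y \<subseteq> S - X" "card Z = 6 * K + 8" "12 * K + 12 \<le> card Y"
      "\<forall>z\<in>Z. \<forall>y\<in>Y. E z y"
    using biclique[OF assms(1) X(1) _ bi] by auto
  have "h \<le> card (nbrs S v)" if "v \<in> S" for v using deg[OF that] by linarith
  then obtain T1 where T1: "T1 \<subseteq> S" "card T1 \<le> k" "card {v \<in> S. nbrs T1 v = {}} \<le> h"
    using dominating_set_const[OF assms(1-3) h(5), of S] unfolding k_def by auto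
  have fT1: "finite T1" using T1 assms(1) finite_subset by blast
  have "h \<le> card (nbrs (S - T1) v)" if "v \<in> S" for v
    using deg[OF that] T1(2) h(8) by (intro card_nbrs_Diff[OF fT1 _ assms(1)]) linarith
  then obtain T2 where T2: "T2 \<subseteq> S - T1" "card T2 \<le> k" "card {v \<in> S. nbrs T2 v = {}} \<le> h"
    using dominating_set_const[OF assms(1-3) h(5), of "S - T1"] unfolding k_def by auto
  have fT2: "finite T2" using T2 assms(1) finite_subset by blast
  define is_link where "is_link = (\<lambda>p tt. is_path S p \<and> hd p = fst tt \<and> last p = snd tt \<and> length p = L)"
  define lnk where "lnk = (\<lambda>tt. SOME p. is_link p tt)"
  \<comment> \<open>The pairs joined by some link of length \<open>L\<close>; one link for each of
    them is fixed now, before the long path is chosen.\<close>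
  define G where "G = {tt \<in> T1 \<times> T2. \<exists>p. is_link p tt}"
  have lnk: "is_link (lnk tt) tt" if "tt \<in> G" for tt
    using that unfolding G_def lnk_def by (metis (mono_tags, lifting) mem_Collect_eq someI_ex)
  define W where "W = T1 \<union> T2 \<union> (\<Union>tt\<in>G. set (lnk tt))"
  have fG: "finite G" using fT1 fT2 by (simp add: G_def)
  have fW: "finite W" using fT1 fT2 fG by (simp add: W_def)
  have cG: "card G \<le> k * k"
  proof -
    have "card G \<le> card (T1 \<times> T2)" using fT1 fT2 by (intro card_mono) (auto simp: G_def)
    also have "\<dots> \<le> k * k" using T1(2) T2(2) by (simp add: card_cartesian_product mult_le_mono)
    finally show ?thesis .
  qed
  have "card (\<Union>tt\<in>G. set (lnk tt)) \<le> (\<Sum>tt\<in>G. card (set (lnk tt)))" by (rule card_UN_le[OF fG])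
  also have "\<dots> \<le> (\<Sum>tt\<in>G. L)"
  proof (rule sum_mono)
    fix tt assume "tt \<in> G"
    then have "length (lnk tt) = L" using lnk by (simp add: is_link_def)
    then show "card (set (lnk tt)) \<le> L" using card_length[of "lnk tt"] by simp
  qed
  also have "\<dots> \<le> k * k * L" using cG by simp
  finally have "card W \<le> 2 * k + k * k * L"
    using T1(2) T2(2) card_Un_le[of "T1 \<union> T2" "\<Union>tt\<in>G. set (lnk tt)"] card_Un_le[of T1 T2]
    unfolding W_def by linarith
  then have cW: "card W \<le> h" using h(3) by linarith
  \<comment> \<open>Since the undominated vertices are removed too, every vertex of
    \<open>S - R\<close> has a neighbour in \<open>T1\<close> and one in \<open>T2\<close>.\<close>
  define R where "R = W \<union> {v \<in> S. nbrs T1 v = {}} \<union> {v \<in> S. nbrs T2 v = {}}"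
  have fR: "finite R" using fW assms(1) by (simp add: R_def)
  have cR: "card R \<le> 3 * h"
    using cW T1(3) T2(3) card_Un_le[of "W \<union> {v \<in> S. nbrs T1 v = {}}" "{v \<in> S. nbrs T2 v = {}}"]
      card_Un_le[of W "{v \<in> S. nbrs T1 v = {}}"] unfolding R_def by linarith
  have cSR: "2 * m \<le> card (S - R)"
    using cR card diff_card_le_card_Diff[OF fR, of S] by linarith
  have "m > 0" using h assms(6) by linarith
  then have "S - R \<noteq> {}" using cSR by force
  moreover have "conn (S - R)"
    by (rule robust_conn[of 0], rule robust_Diff[OF assms(5,1) fR]) (use cR in linarith)
  moreover have "m \<le> card (nbrs (S - R) v)" if "v \<in> S - R" for v
    using deg[of v] that cR by (intro card_nbrs_Diff[OF fR _ assms(1)]) auto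
  ultimately obtain p where p: "is_path (S - R) p" "2 * m \<le> length p"
    using dirac_path[of "S - R" m] assms(1) cSR by auto
  \<comment> \<open>The path contributes \<open>2 * m - L\<close> vertices and the link the other
    \<open>L\<close>; \<open>j\<close> is even because \<open>L\<close> is.\<close>
  define j where "j = 2 * m - L"
  have j: "0 < j" "j + L = 2 * m" "even j" "j \<le> length p"
    using h assms(6) p(2) unfolding j_def by auto
  define p' where "p' = take j p"
  have "successively E (p' @ drop j p)" using p(1) by (simp add: p'_def is_path_def)
  then have "successively E p'" by (simp only: successively_append_iff)
  then have pp: "is_path (S - R) p'" "length p' = j"
    using p(1) j by (auto simp: p'_def is_path_def dest: in_set_takeD)
  then have pS: "is_path S p'" using is_path_subset by blast
  have pn: "p' \<noteq> []" "set p' \<subseteq> S - R" using pp by (auto simp: is_path_def)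
  then have xy: "hd p' \<in> S - R" "last p' \<in> S - R" using hd_in_set last_in_set by blast+
  then have "nbrs T1 (hd p') \<noteq> {}" "nbrs T2 (last p') \<noteq> {}" by (auto simp: R_def)
  then obtain t t' where t: "t \<in> T1" "E (hd p') t" "t' \<in> T2" "E (last p') t'"
    by (auto simp: nbrs_def)
  have tt: "t \<in> S" "t' \<in> S" "t \<noteq> t'" using t T1 T2 by auto
  have "(\<exists>c. colours c S \<and> c t \<noteq> c t') \<or> (\<forall>F c. F \<subseteq> S \<longrightarrow> card F \<le> 2 * h \<longrightarrow> \<not> colours c (S - F))"
  proof (cases "\<exists>c. colours c S")
    case True
    then obtain c where c: "colours c S" by blast
    \<comment> \<open>A path with an even number of vertices has ends of different colours, and so
      their neighbours \<open>t\<close> and \<open>t'\<close> differ as well.\<close>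
    have "c (hd p') \<noteq> c (last p')"
      using colours_path_parity[OF c pS] pp(2) j(3) by simp
    moreover have "c (hd p') \<noteq> c t" "c (last p') \<noteq> c t'"
      using c t tt xy unfolding colours_def by auto
    ultimately have "c t \<noteq> c t'" by auto
    then show ?thesis using c by blast
  next
    case False
    then show ?thesis using par by blast
  qed
  moreover have "Z \<subseteq> S" "Y \<subseteq> S" "Y \<inter> Z = {}" using ZY X by auto
  moreover have "card S \<le> h * K" using assms(2) by (simp add: mult.commute)
  ultimately have "\<exists>p. is_path S p \<and> hd p = t \<and> last p = t' \<and> length p = 6 * K + 4"
    using ZY(5) by (intro exact_link[OF assms(1,5) _ h(1) _ ZY(3) _ ZY(4) _ _ tt]) auto
  \<comment> \<open>The link just found may meet the path. It only shows that the pair is in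
    \<open>G\<close>; the link used is the one fixed earlier, which lies in
    \<open>W\<close>.\<close>
  then have G: "(t, t') \<in> G"
    using t by (auto simp: G_def is_link_def L_def link_len_def)
  define l where "l = lnk (t, t')"
  have l: "is_path S l" "hd l = t" "last l = t'" "length l = L"
    using lnk[OF G] by (auto simp: l_def is_link_def)
  have ln: "l \<noteq> []" using l(1) by (simp add: is_path_def)
  have "set l \<subseteq> R" using G by (auto simp: R_def W_def l_def)
  then have "is_path S (p' @ rev l)"
    using pn t(4) l ln by (intro is_path_append is_path_rev pS) (auto simp: hd_rev)
  moreover have "E (last (p' @ rev l)) (hd (p' @ rev l))"
    using pn(1) ln l(2) t(2) sym by (auto simp: last_rev)
  moreover have "length (p' @ rev l) = 2 * m" using pp(2) l(4) j(2) by simp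
  ultimately show ?thesis unfolding has_cycle_def by blast
qed

lemma has_cycle_mono: "has_cycle S l \<Longrightarrow> S \<subseteq> T \<Longrightarrow> has_cycle T l"
  unfolding has_cycle_def using is_path_subset by blast

text \<open>Either at most \<open>2 * h\<close> deletions make the graph bipartite, and they are
  carried out, or none do; both cases satisfy the parity alternative of
  \<open>robust_even_cycle_aux\<close>. The hypotheses exceed those of that lemma by
  \<open>2 * h\<close> to pay for the deletions.\<close>

lemma robust_even_cycle:
  assumes "finite S" "card S \<le> K * h" "K > 0" "big_enough K \<le> h" "robust (6 * h) S" "h \<le> m"
    and deg: "\<And>v. v \<in> S \<Longrightarrow> m + 5 * h \<le> card (nbrs S v)" and card: "2 * m + 5 * h \<le> card S"
  shows "has_cycle S (2 * m)"
proof (cases "\<exists>F c. F \<subseteq> S \<and> card F \<le> 2 * h \<and> colours c (S - F)")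
  case True
  then obtain F c where F: "F \<subseteq> S" "card F \<le> 2 * h" "colours c (S - F)" by blast
  have fF: "finite F" using F assms(1) finite_subset by blast
  have "has_cycle (S - F) (2 * m)"
  proof (rule robust_even_cycle_aux)
    show "card (S - F) \<le> K * h" using assms(1,2) by (meson Diff_subset card_mono le_trans)
    show "robust (4 * h) (S - F)"
      by (rule robust_Diff[OF assms(5,1) fF]) (use F(2) in linarith)
    show "m + 3 * h \<le> card (nbrs (S - F) v)" if "v \<in> S - F" for v
      using deg[of v] that F(2) by (intro card_nbrs_Diff[OF fF _ assms(1)]) auto
    show "2 * m + 3 * h \<le> card (S - F)"
      using card F(2) diff_card_le_card_Diff[OF fF, of S] by linarith
  qed (use assms F in auto)
  then show ?thesis by (rule has_cycle_mono) blast
next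
  case False
  have "robust (4 * h) S" by (rule robust_mono[OF assms(5)]) simp
  moreover have "m + 3 * h \<le> card (nbrs S v)" if "v \<in> S" for v using deg[OF that] by linarith
  moreover have "2 * m + 3 * h \<le> card S" using card by linarith
  ultimately show ?thesis using robust_even_cycle_aux[OF assms(1-4) _ assms(6)] False by blast
qed

end

section \<open>Matchings, near-cliques and separated decompositions\<close>

text \<open>Listing the ends of all pairs lets the single condition
  \<open>distinct (flat ps)\<close> express that the pairs are proper and disjoint; positions in
  this list later number the vertices of the fan.\<close>

definition flat :: "('a \<times> 'a) list \<Rightarrow> 'a list" where
  "flat ps = concat (map (\<lambda>(x, y). [x, y]) ps)"

lemma flat_simps [simp]:
  "flat [] = []" "flat ((x, y) # ps) = x # y # flat ps" "flat (ps @ qs) = flat ps @ flat qs"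
  by (simp_all add: flat_def)

lemma length_flat: "length (flat ps) = 2 * length ps"
  by (induction ps) auto

lemma set_flat: "set (flat ps) = fst ` set ps \<union> snd ` set ps"
proof (induction ps)
  case (Cons a ps)
  then show ?case by (cases a) (simp add: insert_commute)
qed simp

context adjacency begin

definition is_matching :: "'a set \<Rightarrow> ('a \<times> 'a) list \<Rightarrow> bool" where
  "is_matching D ps \<longleftrightarrow> distinct (flat ps) \<and> set (flat ps) \<subseteq> D \<and> (\<forall>(x, y) \<in> set ps. E x y)"

text \<open>The bound \<open>n\<close> provides a matching of maximum size. An edge between
  unmatched vertices could be added to it, and replacing \<open>(x, y)\<close> by
  \<open>(x, p)\<close> and \<open>(y, q)\<close> would enlarge it.\<close>

lemma maximal_matching:
  assumes "finite D" and none: "\<And>ps. is_matching D ps \<Longrightarrow> length ps < n"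
  obtains ps where "is_matching D ps"
    "\<forall>p \<in> D - set (flat ps). \<forall>q \<in> D - set (flat ps). \<not> E p q"
    "\<forall>x y. (x, y) \<in> set ps \<longrightarrow> (\<forall>p \<in> D - set (flat ps). \<forall>q \<in> D - set (flat ps). p \<noteq> q \<longrightarrow>
       \<not> (E x p \<and> E y q))"
proof -
  have "is_matching D []" by (simp add: is_matching_def)
  then have "\<exists>ps. is_matching D ps \<and> (\<forall>qs. is_matching D qs \<longrightarrow> length qs \<le> length ps)"
    using none by (intro ex_has_greatest_nat[of "is_matching D" "[]" length n]) auto
  then obtain ps where ps: "is_matching D ps"
    and max: "\<And>qs. is_matching D qs \<Longrightarrow> length qs \<le> length ps" by blast
  let ?I = "D - set (flat ps)"
  have "\<not> E p q" if "p \<in> ?I" "q \<in> ?I" for p q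
  proof
    assume "E p q"
    then have "is_matching D ((p, q) # ps)"
      using ps that irrefl by (auto simp: is_matching_def)
    then show False using max by fastforce
  qed
  moreover have "\<not> (E x p \<and> E y q)" if xy: "(x, y) \<in> set ps" and pq: "p \<in> ?I" "q \<in> ?I" "p \<noteq> q" for x y p q
  proof
    assume e: "E x p \<and> E y q"
    obtain as bs where ab: "ps = as @ (x, y) # bs" using xy by (metis split_list)
    have "is_matching D (as @ (x, p) # (y, q) # bs)"
      using ps pq e unfolding ab is_matching_def by auto
    then show False using max ab by fastforce
  qed
  ultimately show ?thesis by (intro that[OF ps]) simp_all
qed

text \<open>Built greedily from the far end: a new vertex of \<open>I\<close> has to avoid those
  already used and at most one vertex missed by each of its two neighbours, for which the margin 3
  suffices. \<open>y0\<close> stands for the vertex that the induction puts in front next.\<close>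

lemma alternating_path:
  assumes "finite I" "distinct ys" "set ys \<inter> I = {}" "length ys + 3 \<le> card I"
    "\<And>y. y \<in> set ys \<Longrightarrow> card {p \<in> I. \<not> E y p} \<le> 1" "card {p \<in> I. \<not> E y0 p} \<le> 1"
  shows "\<exists>p. is_path (I \<union> set ys) p \<and> length p = 2 * length ys + 1 \<and> hd p \<in> I \<and> last p \<in> I \<and>
    E y0 (hd p) \<and> card (set p \<inter> I) = length ys + 1"
  using assms(2-6)
proof (induction ys arbitrary: y0)
  case Nil
  have "\<not> I \<subseteq> {p \<in> I. \<not> E y0 p}"
  proof
    assume "I \<subseteq> {p \<in> I. \<not> E y0 p}"
    then have "card I \<le> card {p \<in> I. \<not> E y0 p}" using assms(1) by (intro card_mono) auto
    then show False using Nil by simp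
  qed
  then obtain i where "i \<in> I" "E y0 i" by blast
  then show ?case by (intro exI[of _ "[i]"]) (auto simp: is_path_def)
next
  case (Cons y ys)
  have "\<exists>p. is_path (I \<union> set ys) p \<and> length p = 2 * length ys + 1 \<and> hd p \<in> I \<and> last p \<in> I \<and>
    E y (hd p) \<and> card (set p \<inter> I) = length ys + 1"
    by (rule Cons.IH) (use Cons.prems in auto)
  then obtain p where p: "is_path (I \<union> set ys) p" "length p = 2 * length ys + 1" "hd p \<in> I"
    "last p \<in> I" "E y (hd p)" "card (set p \<inter> I) = length ys + 1" by blast
  let ?X = "(set p \<inter> I) \<union> ({p \<in> I. \<not> E y0 p} \<union> {p \<in> I. \<not> E y p})"
  have "card ?X \<le> length ys + 3"
    using card_Un_le[of "set p \<inter> I" "{p \<in> I. \<not> E y0 p} \<union> {p \<in> I. \<not> E y p}"]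
      card_Un_le[of "{p \<in> I. \<not> E y0 p}" "{p \<in> I. \<not> E y p}"] p(6) Cons.prems(4)[of y] Cons.prems(5)
    by simp
  have "\<not> I \<subseteq> ?X"
  proof
    assume "I \<subseteq> ?X"
    then have "card I \<le> card ?X" using assms(1) by (intro card_mono) auto
    then show False using Cons.prems(3) \<open>card ?X \<le> length ys + 3\<close> by simp
  qed
  then obtain i where i: "i \<in> I" "i \<notin> set p" "E y0 i" "E y i" by blast
  have "y \<notin> set p" using p(1) Cons.prems(1,2) by (auto simp: is_path_def)
  then have "is_path (I \<union> set (y # ys)) (i # y # p)"
    using p i Cons.prems(2) sym by (auto simp: is_path_def successively_Cons)
  moreover have "set (i # y # p) \<inter> I = insert i (set p \<inter> I)"
    using i Cons.prems(2) by auto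
  then have "card (set (i # y # p) \<inter> I) = Suc (card (set p \<inter> I))"
    using i(2) by simp
  ultimately show ?case
    using p i by (intro exI[of _ "i # y # p"]) (auto simp: is_path_def)
qed

lemma clique_successively:
  "(\<And>u v. u \<in> I \<Longrightarrow> v \<in> I \<Longrightarrow> u \<noteq> v \<Longrightarrow> E u v) \<Longrightarrow> distinct xs \<Longrightarrow> set xs \<subseteq> I \<Longrightarrow> successively E xs"
  by (induction xs rule: induct_list012) auto

lemma clique_even_cycle:
  assumes "finite I" "distinct ys" "set ys \<inter> I = {}"
    and clique: "\<And>u v. u \<in> I \<Longrightarrow> v \<in> I \<Longrightarrow> u \<noteq> v \<Longrightarrow> E u v"
    and miss: "\<And>y. y \<in> set ys \<Longrightarrow> card {p \<in> I. \<not> E y p} \<le> 1"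
    and m: "1 \<le> m" "m + 3 \<le> card I" "2 * m + 3 \<le> card I + length ys"
  shows "has_cycle (I \<union> set ys) (2 * m)"
proof -
  \<comment> \<open>The cap \<open>m - 1\<close> keeps the alternating path below
    \<open>2 * m\<close> vertices, so at least one clique vertex is left to close it.\<close>
  define l where "l = min (length ys) (m - 1)"
  define zs where "zs = take l ys"
  have zs: "length zs = l" "distinct zs" "set zs \<subseteq> set ys"
    using assms(2) by (auto simp: zs_def l_def dest: in_set_takeD)
  have l: "l + 1 \<le> m" "l + 3 \<le> card I" "2 * m \<le> card I + l" using m by (auto simp: l_def)
  obtain i where i: "i \<in> I" using m(2) by fastforce
  have "{p \<in> I. \<not> E i p} \<subseteq> {i}" using clique[OF i] by auto
  then have ci: "card {p \<in> I. \<not> E i p} \<le> 1" using card_mono[of "{i}"] by simp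
  have "\<exists>p. is_path (I \<union> set zs) p \<and> length p = 2 * length zs + 1 \<and> hd p \<in> I \<and> last p \<in> I \<and>
    E i (hd p) \<and> card (set p \<inter> I) = length zs + 1"
    by (rule alternating_path[OF assms(1) zs(2) _ _ _ ci]) (use assms(3) zs l miss in auto)
  then obtain p where p: "is_path (I \<union> set zs) p" "length p = 2 * l + 1" "hd p \<in> I" "last p \<in> I"
    "card (set p \<inter> I) = l + 1" using zs(1) by auto
  have "card I - card (set p \<inter> I) \<le> card (I - (set p \<inter> I))"
    by (rule diff_card_le_card_Diff) simp
  then have "2 * m - (2 * l + 1) \<le> card (I - (set p \<inter> I))" using p(5) l by linarith
  then obtain R where R: "R \<subseteq> I - (set p \<inter> I)" "card R = 2 * m - (2 * l + 1)"
    by (meson obtain_subset_with_card_n)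
  then have "finite R" using assms(1) by (meson Diff_subset finite_subset)
  then obtain rs where rs: "set rs = R" "distinct rs" using finite_distinct_list by blast
  have lr: "length rs = 2 * m - (2 * l + 1)" using rs R(2) distinct_card by fastforce
  then have rn: "rs \<noteq> []" using l by auto
  have rsI: "set rs \<subseteq> I" "set p \<inter> set rs = {}" using rs R by auto
  have "is_path I rs" using rn rs rsI clique_successively[OF clique] by (auto simp: is_path_def)
  then have rp: "is_path (I \<union> set ys) rs" by (rule is_path_subset) auto
  have pp: "is_path (I \<union> set ys) p" using p(1) by (rule is_path_subset) (use zs in auto)
  have pn: "p \<noteq> []" using p(2) by auto
  have "hd rs \<in> I" "last rs \<in> I" "last p \<noteq> hd rs" "last rs \<noteq> hd p"
    using rn rsI pn by (metis disjoint_iff hd_in_set last_in_set subsetD)+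
  then have "E (last p) (hd rs)" "E (last rs) (hd p)" using clique p by auto
  then have "is_path (I \<union> set ys) (p @ rs)" "E (last (p @ rs)) (hd (p @ rs))"
    using pp rp rsI(2) rn pn by (auto intro: is_path_append)
  moreover have "length (p @ rs) = 2 * m" using p(2) lr l by simp
  ultimately show ?thesis unfolding has_cycle_def by blast
qed

section \<open>Pieces without edges between them\<close>

definition separated :: "'a set set \<Rightarrow> bool" where
  "separated P \<longleftrightarrow> (\<forall>A\<in>P. A \<noteq> {}) \<and>
     (\<forall>A\<in>P. \<forall>B\<in>P. A \<noteq> B \<longrightarrow> A \<inter> B = {} \<and> (\<forall>a\<in>A. \<forall>b\<in>B. \<not> E a b))"

lemma separated_nbrs:
  assumes "finite V" "separated P" "\<Union>P \<subseteq> V" "A \<in> P" "v \<in> A" "d + card (V - \<Union>P) \<le> card (nbrs V v)"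
  shows "d \<le> card (nbrs A v)"
proof -
  have "nbrs V v \<subseteq> nbrs A v \<union> (V - \<Union>P)"
    using assms(2,4,5) unfolding separated_def nbrs_def by fastforce
  moreover have "finite (nbrs A v)" using assms by (meson Sup_upper finite_nbrs finite_subset order_trans)
  ultimately have "card (nbrs V v) \<le> card (nbrs A v) + card (V - \<Union>P)"
    using assms(1) by (meson card_Un_le card_mono finite_Diff finite_UnI le_trans)
  then show ?thesis using assms(6) by linarith
qed

lemma separated_refine:
  assumes "separated P" "A \<in> P" "A1 \<subseteq> A" "A2 \<subseteq> A" "A1 \<inter> A2 = {}" "A1 \<noteq> {}" "A2 \<noteq> {}"
    "\<And>a b. a \<in> A1 \<Longrightarrow> b \<in> A2 \<Longrightarrow> \<not> E a b" "finite P"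
  shows "separated (insert A1 (insert A2 (P - {A})))"
    "card (insert A1 (insert A2 (P - {A}))) = Suc (card P)"
proof -
  have old: "B \<inter> C = {} \<and> (\<forall>b\<in>B. \<forall>c\<in>C. \<not> E b c)" if "B \<in> P" "C \<in> P" "B \<noteq> C" for B C
    using assms(1) that unfolding separated_def by simp
  have mixed: "A' \<inter> B = {} \<and> (\<forall>a\<in>A'. \<forall>b\<in>B. \<not> E a b \<and> \<not> E b a)"
    if "A' \<subseteq> A" "B \<in> P - {A}" for A' B
    using old[of A B] that assms(2) sym by blast
  have new: "\<not> E a b \<and> \<not> E b a" if "a \<in> A1" "b \<in> A2" for a b
    using assms(8) that sym by blast
  have ne: "B \<noteq> {}" if "B \<in> P" for B using assms(1) that unfolding separated_def by blast
  show "separated (insert A1 (insert A2 (P - {A})))"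
    unfolding separated_def
  proof (intro conjI ballI impI)
    fix B assume "B \<in> insert A1 (insert A2 (P - {A}))"
    then show "B \<noteq> {}" using assms(6,7) ne by auto
  next
    fix B C assume B: "B \<in> insert A1 (insert A2 (P - {A}))" and C: "C \<in> insert A1 (insert A2 (P - {A}))"
      and BC: "B \<noteq> C"
    consider "B = A1 \<and> C = A2" | "B = A2 \<and> C = A1" | "B \<subseteq> A \<and> C \<in> P - {A}" | "C \<subseteq> A \<and> B \<in> P - {A}"
      | "B \<in> P \<and> C \<in> P"
      using B C BC assms(3,4) by blast
    then have *: "B \<inter> C = {} \<and> (\<forall>b\<in>B. \<forall>c\<in>C. \<not> E b c)"
    proof cases
      case 1
      then show ?thesis using assms(5) new by blast
    next
      case 2
      then show ?thesis using assms(5) new by blast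
    next
      case 3
      then show ?thesis using mixed[of B C] by blast
    next
      case 4
      then show ?thesis using mixed[of C B] by blast
    next
      case 5
      then show ?thesis using old[of B C] BC by blast
    qed
    then show "B \<inter> C = {}" by blast
    fix b c assume "b \<in> B" "c \<in> C"
    then show "\<not> E b c" using * by blast
  qed
  have "A1 \<notin> P - {A}" "A2 \<notin> P - {A}" "A1 \<noteq> A2"
    using mixed[OF assms(3)] mixed[OF assms(4)] assms(5-7) by blast+
  then have "card (insert A1 (insert A2 (P - {A}))) = Suc (Suc (card (P - {A})))"
    using assms(9) by simp
  also have "\<dots> = Suc (card P)" using assms(2,9) by (metis card_Suc_Diff1)
  finally show "card (insert A1 (insert A2 (P - {A}))) = Suc (card P)" .
qed

lemma disjoint_union_card:
  assumes "separated P" "finite (\<Union>P)" "finite P"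
  shows "card (\<Union>P) = (\<Sum>A\<in>P. card A)"
  using assms by (intro card_Union_disjoint)
    (auto simp: separated_def pairwise_def disjnt_def intro: finite_subset[of _ "\<Union>P"])

text \<open>While some piece is not robust, delete a cut of at most \<open>k\<close> vertices and
  split the piece. The degree surplus pays for \<open>C + 1\<close> rounds, so all degrees stay at
  least \<open>d \<ge> w\<close>, every piece has at least \<open>w\<close> vertices, and there are
  never more than \<open>C\<close> pieces.\<close>

lemma robust_decomposition:
  assumes "finite V" "V \<noteq> {}" "card V \<le> C * w" "0 < w" "w \<le> d"
    and deg: "\<And>v. v \<in> V \<Longrightarrow> d + (C + 1) * k \<le> card (nbrs V v)"
  shows "\<exists>P. finite P \<and> separated P \<and> \<Union>P \<subseteq> V \<and> card (V - \<Union>P) \<le> C * k \<and>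
    (\<forall>A\<in>P. robust k A \<and> (\<forall>v\<in>A. d \<le> card (nbrs A v)))"
proof (rule ccontr)
  assume contr: "\<not> ?thesis"
  define dec where "dec = (\<lambda>j P. finite P \<and> card P = j \<and> separated P \<and> \<Union>P \<subseteq> V \<and> card (V - \<Union>P) \<le> j * k)"
  have degA: "d \<le> card (nbrs A v)" if "dec j P" "j \<le> C + 1" "A \<in> P" "v \<in> A" for j P A v
  proof -
    have "v \<in> V" using that unfolding dec_def by blast
    moreover have "card (V - \<Union>P) \<le> (C + 1) * k"
      using that(1,2) unfolding dec_def by (meson le_trans mult_le_mono1)
    ultimately have "d + card (V - \<Union>P) \<le> card (nbrs V v)" using deg[of v] by simp
    moreover have "separated P" "\<Union>P \<subseteq> V" using that(1) by (auto simp: dec_def)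
    ultimately show ?thesis using separated_nbrs[OF assms(1)] that(3,4) by blast
  qed
  have bound: "j \<le> C" if dec: "dec j P" and "j \<le> C + 1" for j P
  proof -
    have "\<Union>P \<subseteq> V" "separated P" "finite P" "card P = j" using dec by (auto simp: dec_def)
    then have fU: "finite (\<Union>P)" using assms(1) finite_subset by blast
    have "w \<le> card A" if A: "A \<in> P" for A
    proof -
      obtain v where v: "v \<in> A" using \<open>separated P\<close> A unfolding separated_def by blast
      have "finite A" using finite_subset[OF Union_upper[OF A] fU] .
      then have "card (nbrs A v) \<le> card A" by (intro card_mono) (auto simp: nbrs_def)
      then show ?thesis using degA[OF dec \<open>j \<le> C + 1\<close> A v] assms(5) by linarith
    qed
    then have "(\<Sum>A\<in>P. w) \<le> (\<Sum>A\<in>P. card A)" by (rule sum_mono)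
    also have "\<dots> = card (\<Union>P)" using disjoint_union_card \<open>separated P\<close> \<open>finite P\<close> fU by simp
    also have "\<dots> \<le> card V" using \<open>\<Union>P \<subseteq> V\<close> assms(1) by (intro card_mono) auto
    finally have "j * w \<le> card V" using \<open>card P = j\<close> by simp
    then have "j * w \<le> C * w" using assms(3) by (rule le_trans)
    then show ?thesis using assms(4) by simp
  qed
  \<comment> \<open>The negated claim keeps the splitting going until there are \<open>C + 1\<close>
    pieces, one more than \<open>bound\<close> allows.\<close>
  have "\<exists>P. dec (Suc j) P" if "j \<le> C" for j
    using that
  proof (induction j)
    case 0
    have "dec (Suc 0) {V}" using assms(2) by (simp add: dec_def separated_def)
    then show ?case by blast
  next
    case (Suc j)
    then obtain P where P: "dec (Suc j) P" by auto
    then have P': "finite P" "card P = Suc j" "separated P" "\<Union>P \<subseteq> V" "card (V - \<Union>P) \<le> Suc j * k"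
      by (auto simp: dec_def)
    have "Suc j * k \<le> C * k" using Suc.prems by (intro mult_le_mono1)
    then have cX: "card (V - \<Union>P) \<le> C * k" using P'(5) by linarith
    have dA: "d \<le> card (nbrs A v)" if "A \<in> P" "v \<in> A" for A v
      using degA[OF P _ that] Suc.prems by simp
    have "\<not> (\<forall>A\<in>P. robust k A)"
    proof
      assume "\<forall>A\<in>P. robust k A"
      then have "finite P \<and> separated P \<and> \<Union>P \<subseteq> V \<and> card (V - \<Union>P) \<le> C * k \<and>
        (\<forall>A\<in>P. robust k A \<and> (\<forall>v\<in>A. d \<le> card (nbrs A v)))"
        using P' cX dA by simp
      then show False by (rule notE[OF contr, OF exI[of _ P]])
    qed
    then obtain A where A: "A \<in> P" "\<not> robust k A" by blast
    then obtain F where F: "F \<subseteq> A" "card F \<le> k" "\<not> conn (A - F)" unfolding robust_def by blast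
    then obtain A1 where A1: "A1 \<subseteq> A - F" "A1 \<noteq> {}" "A1 \<noteq> A - F"
      "\<And>a b. a \<in> A1 \<Longrightarrow> b \<in> A - F - A1 \<Longrightarrow> \<not> E a b"
      unfolding conn_def by blast
    let ?P = "insert A1 (insert (A - F - A1) (P - {A}))"
    have ref: "separated ?P" "card ?P = Suc (card P)"
      using A1 A by (auto intro!: separated_refine[OF P'(3) A(1) _ _ _ _ _ _ P'(1)])
    have "A \<subseteq> V" using A P'(4) by blast
    then have "finite A" using assms(1) finite_subset by blast
    then have fF: "finite F" using F finite_subset by blast
    have "V - \<Union>?P \<subseteq> (V - \<Union>P) \<union> F" by auto
    then have "card (V - \<Union>?P) \<le> card ((V - \<Union>P) \<union> F)" using assms(1) fF by (intro card_mono) auto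
    also have "\<dots> \<le> card (V - \<Union>P) + card F" by (rule card_Un_le)
    also have "\<dots> \<le> Suc (Suc j) * k" using P'(5) F(2) by simp
    finally have "card (V - \<Union>?P) \<le> Suc (Suc j) * k" .
    moreover have "\<Union>?P \<subseteq> V" using P'(4) A A1 by blast
    ultimately have "dec (Suc (Suc j)) ?P" using ref P' unfolding dec_def by simp
    then show ?case by blast
  qed
  then obtain P where "dec (Suc C) P" by blast
  then have "Suc C \<le> C" by (rule bound) simp
  then show False by simp
qed

end

section \<open>Red cycles versus blue fans\<close>

locale two_colours = red: adjacency E + blue: adjacency H
  for E H :: "'a \<Rightarrow> 'a \<Rightarrow> bool" +
  assumes red_or_blue: "u \<noteq> v \<Longrightarrow> E u v \<or> H u v"
begin

text \<open>The vertices missed by a maximum blue matching form a red clique, and every matching edge has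
  an end that is red to all but at most one of them, since otherwise the matching could be augmented.\<close>

lemma blue_matching_or_red_cycle:
  assumes "finite D" "1 \<le> m" "2 * n + m + 3 \<le> card D" "2 * m + n + 3 \<le> card D"
    and none: "\<And>ps. blue.is_matching D ps \<Longrightarrow> length ps < n"
  shows "red.has_cycle D (2 * m)"
proof -
  obtain ps where ps: "blue.is_matching D ps"
    and indep0: "\<forall>p \<in> D - set (flat ps). \<forall>q \<in> D - set (flat ps). \<not> H p q"
    and aug0: "\<forall>x y. (x, y) \<in> set ps \<longrightarrow> (\<forall>p \<in> D - set (flat ps). \<forall>q \<in> D - set (flat ps). p \<noteq> q \<longrightarrow>
       \<not> (H x p \<and> H y q))"
    by (rule blue.maximal_matching[OF assms(1) none])
  note indep = indep0[rule_format] and aug = aug0[rule_format]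
  define I where "I = D - set (flat ps)"
  have m: "distinct (flat ps)" "set (flat ps) \<subseteq> D" using ps by (auto simp: blue.is_matching_def)
  have l: "length ps < n" using none ps by blast
  have "card (set (flat ps)) = 2 * length ps" using m(1) by (simp add: distinct_card length_flat)
  then have cI: "card I = card D - 2 * length ps"
    unfolding I_def using m(2) by (simp add: card_Diff_subset)
  define B where "B = (\<lambda>y. {p \<in> I. \<not> E y p})"
  have fI: "finite I" using assms(1) by (simp add: I_def)
  have BH: "H y p" if "p \<in> B y" "y \<in> set (flat ps)" for y p
    using that red_or_blue[of y p] by (auto simp: B_def I_def)
  have small: "card (B x) \<le> 1 \<or> card (B y) \<le> 1" if xy: "(x, y) \<in> set ps" for x y
  proof (rule ccontr)
    assume "\<not> ?thesis"
    then have c: "2 \<le> card (B x)" "1 \<le> card (B y)" by auto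
    have xyf: "x \<in> set (flat ps)" "y \<in> set (flat ps)" using xy by (force simp: set_flat)+
    obtain q where q: "q \<in> B y" using c(2) by fastforce
    have "\<not> B x \<subseteq> {q}"
    proof
      assume "B x \<subseteq> {q}"
      then have "card (B x) \<le> card {q}" by (intro card_mono) auto
      then show False using c(1) by simp
    qed
    then obtain p where p: "p \<in> B x" "p \<noteq> q" by blast
    have "p \<in> D - set (flat ps)" "q \<in> D - set (flat ps)" using p q by (auto simp: B_def I_def)
    then show False using aug[OF xy] BH p q xyf by blast
  qed
  define pick where "pick = (\<lambda>(x, y). if card (B x) \<le> 1 then x else y)"
  define ys where "ys = map pick ps"
  have pick: "pick a \<in> {fst a, snd a}" for a by (auto simp: pick_def split: prod.splits)
  have sub: "set (map pick qs) \<subseteq> set (flat qs)" for qs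
    using pick by (force simp: set_flat)
  have "distinct (map pick qs)" if "distinct (flat qs)" for qs
    using that
  proof (induction qs)
    case (Cons a qs)
    obtain x y where a: "a = (x, y)" by (cases a)
    have "pick a \<notin> set (flat qs)" using Cons.prems pick[of a] by (auto simp: a)
    then have "pick a \<notin> set (map pick qs)" using sub by blast
    then show ?case using Cons by (auto simp: a)
  qed simp
  then have ys: "distinct ys" "set ys \<subseteq> set (flat ps)" "length ys = length ps"
    using m(1) sub by (auto simp: ys_def)
  have "red.has_cycle (I \<union> set ys) (2 * m)"
  proof (rule red.clique_even_cycle[OF fI ys(1)])
    show "set ys \<inter> I = {}" using ys(2) by (auto simp: I_def)
    show "E u v" if "u \<in> I" "v \<in> I" "u \<noteq> v" for u v
      using red_or_blue[OF that(3)] indep that(1,2) by (auto simp: I_def)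
    show "card {p \<in> I. \<not> E y p} \<le> 1" if y: "y \<in> set ys" for y
    proof -
      obtain a where a: "a \<in> set ps" "y = pick a" using y by (auto simp: ys_def)
      then have "card (B y) \<le> 1" using small[of "fst a" "snd a"] by (auto simp: pick_def split: prod.splits)
      then show ?thesis by (simp add: B_def)
    qed
  qed (use assms(2-4) l cI ys(3) in auto)
  moreover have "I \<union> set ys \<subseteq> D" using ys(2) m(2) by (auto simp: I_def)
  ultimately show ?thesis by (rule red.has_cycle_mono)
qed

text \<open>The centre lies in a smallest piece \<open>A\<close>, joined in blue to the union
  \<open>R\<close> of the others. If a maximum blue matching of \<open>R\<close> has fewer than
  \<open>n\<close> edges, its unmatched vertices lie in one piece \<open>B\<close> and every
  matching edge meets \<open>B\<close>, so \<open>R - B\<close> has fewer than \<open>n\<close>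
  vertices. By \<open>2 * b < card (\<Union>P)\<close> it contains a third piece, at least as large
  as \<open>A\<close>, and the total falls below \<open>b + 2 * n\<close>.\<close>

lemma blue_fan_in_separated:
  assumes "finite P" "red.separated P" "finite (\<Union>P)"
    and small: "\<And>A. A \<in> P \<Longrightarrow> card A \<le> b" and large: "b + 2 * n \<le> card (\<Union>P)" "2 * b < card (\<Union>P)"
  shows "\<exists>v\<in>\<Union>P. \<exists>ps. blue.is_matching (blue.nbrs (\<Union>P) v) ps \<and> n \<le> length ps"
proof -
  have "P \<noteq> {}" using large(2) by auto
  obtain A where A: "A \<in> P" "\<And>B. B \<in> P \<Longrightarrow> card A \<le> card B"
    using arg_min_if_finite[OF assms(1) \<open>P \<noteq> {}\<close>, of card] by (metis linorder_not_le)
  have fin: "finite B" if "B \<in> P" for B using finite_subset[OF Union_upper[OF that] assms(3)] .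
  have blue: "H u v" if "u \<in> B" "v \<in> C" "B \<in> P" "C \<in> P" "B \<noteq> C" for u v B C
  proof -
    have "\<not> E u v" "u \<noteq> v" using assms(2) that unfolding red.separated_def by blast+
    then show ?thesis using red_or_blue by blast
  qed
  have rest: "card (\<Union>P) = card (\<Union>(P - Q)) + (\<Sum>B\<in>Q. card B)" if "Q \<subseteq> P" for Q
  proof -
    have "red.separated (P - Q)" using assms(2) unfolding red.separated_def by (simp, blast)
    moreover have "finite (\<Union>(P - Q))" by (rule finite_subset[OF _ assms(3)]) blast
    ultimately have "card (\<Union>(P - Q)) = (\<Sum>B\<in>P - Q. card B)"
      using red.disjoint_union_card assms(1) by blast
    then show ?thesis
      using red.disjoint_union_card[OF assms(2,3,1)] sum.subset_diff[OF that assms(1), of card] by simp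
  qed
  define R where "R = \<Union>(P - {A})"
  have fR: "finite R" unfolding R_def by (rule finite_subset[OF _ assms(3)]) blast
  have cR: "card (\<Union>P) = card R + card A" using rest[of "{A}"] A(1) by (simp add: R_def)
  have "\<exists>ps. blue.is_matching R ps \<and> n \<le> length ps"
  proof (rule ccontr)
    assume "\<not> ?thesis"
    then have none: "\<And>ps. blue.is_matching R ps \<Longrightarrow> length ps < n" by (meson linorder_not_le)
    obtain ps where ps: "blue.is_matching R ps"
      and indep0: "\<forall>p \<in> R - set (flat ps). \<forall>q \<in> R - set (flat ps). \<not> H p q"
      and aug0: "\<forall>x y. (x, y) \<in> set ps \<longrightarrow> (\<forall>p \<in> R - set (flat ps). \<forall>q \<in> R - set (flat ps). p \<noteq> q \<longrightarrow>
         \<not> (H x p \<and> H y q))"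
      by (rule blue.maximal_matching[OF fR none])
    note indep = indep0[rule_format] and aug = aug0[rule_format]
    have m: "distinct (flat ps)" "set (flat ps) \<subseteq> R" using ps by (auto simp: blue.is_matching_def)
    have l: "length ps < n" using none ps by blast
    have "card (set (flat ps)) = 2 * length ps" using m(1) by (simp add: distinct_card length_flat)
    then have "card (R - set (flat ps)) = card R - 2 * length ps"
      using m(2) by (simp add: card_Diff_subset)
    moreover have "2 * n \<le> card R" using cR small[OF A(1)] large(1) by linarith
    ultimately have cI: "2 \<le> card (R - set (flat ps))" using l by linarith
    then have "R - set (flat ps) \<noteq> {}" by (metis card.empty not_numeral_le_zero)
    then obtain p where p: "p \<in> R - set (flat ps)" by blast
    have "\<not> R - set (flat ps) \<subseteq> {p}"
    proof
      assume "R - set (flat ps) \<subseteq> {p}"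
      then have "card (R - set (flat ps)) \<le> card {p}" by (intro card_mono) auto
      then show False using cI by simp
    qed
    then obtain q where q: "q \<in> R - set (flat ps)" "p \<noteq> q" by blast
    obtain B where B: "B \<in> P" "B \<noteq> A" "p \<in> B" using p by (auto simp: R_def)
    have out: "H x z" if xz: "x \<in> R" "x \<notin> B" "z \<in> B" for x z
    proof -
      obtain C where "C \<in> P" "x \<in> C" using xz(1) by (auto simp: R_def)
      then show ?thesis using blue[of x C z B] xz B by blast
    qed
    have IB: "z \<in> B" if "z \<in> R - set (flat ps)" for z
      using out[of z p] indep[OF that p] that B(3) by blast
    have xB: "x \<in> B \<or> y \<in> B" if xy: "(x, y) \<in> set ps" for x y
    proof (rule ccontr)
      assume n: "\<not> ?thesis"
      have "x \<in> R" "y \<in> R" using xy m(2) by (force simp: set_flat)+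
      then have "H x p" "H y q" using out n IB[OF p] IB[OF q(1)] by blast+
      then show False using aug[OF xy p q] by blast
    qed
    \<comment> \<open>Every vertex of \<open>R - B\<close> is matched, and its partner lies in
      \<open>B\<close>.\<close>
    have "R - B \<subseteq> (\<lambda>(x, y). if x \<in> B then y else x) ` set ps"
    proof
      fix z assume z: "z \<in> R - B"
      then have "z \<in> set (flat ps)" using IB by blast
      then obtain x y where xy: "(x, y) \<in> set ps" "z = x \<or> z = y" by (auto simp: set_flat)
      then have "(\<lambda>(x, y). if x \<in> B then y else x) (x, y) = z" using z xB[OF xy(1)] by auto
      then show "z \<in> (\<lambda>(x, y). if x \<in> B then y else x) ` set ps" using xy(1) by blast
    qed
    then have "card (R - B) \<le> card (set ps)"
      by (meson List.finite_set card_image_le card_mono finite_imageI le_trans)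
    then have "card (R - B) < n" using card_length[of ps] l by linarith
    moreover have RB: "R - B = \<Union>(P - {A, B})"
    proof -
      have "C \<inter> B = {}" if "C \<in> P" "C \<noteq> B" for C
        using assms(2) that B(1) unfolding red.separated_def by blast
      then show ?thesis by (auto simp: R_def)
    qed
    moreover have c3: "card (\<Union>P) = card (\<Union>(P - {A, B})) + (card A + card B)"
      using rest[of "{A, B}"] A(1) B by simp
    moreover have "card A \<le> card (\<Union>(P - {A, B}))"
    proof -
      have "P - {A, B} \<noteq> {}"
      proof
        assume "P - {A, B} = {}"
        then have "card (\<Union>(P - {A, B})) = 0" by (simp only: Union_empty card.empty)
        then have "card (\<Union>P) = card A + card B" using c3 by linarith
        then show False using small[OF A(1)] small[OF B(1)] large(2) by linarith
      qed
      then obtain C where C: "C \<in> P - {A, B}" by blast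
      then have "card C \<le> card (\<Union>(P - {A, B}))"
        by (intro card_mono finite_subset[OF _ assms(3)]) auto
      then show ?thesis using A(2)[of C] C by auto
    qed
    ultimately show False using large(1) small[OF B(1)] unfolding RB by linarith
  qed
  then obtain ps where ps: "blue.is_matching R ps" "n \<le> length ps" by blast
  obtain v where v: "v \<in> A" using assms(2) A(1) unfolding red.separated_def by blast
  have "R \<subseteq> blue.nbrs (\<Union>P) v"
    using blue[OF v] A(1) by (auto simp: R_def blue.nbrs_def)
  then have "blue.is_matching (blue.nbrs (\<Union>P) v) ps" using ps(1) by (auto simp: blue.is_matching_def)
  then show ?thesis using ps(2) v A(1) by blast
qed

lemma is_matching_mono: "blue.is_matching D ps \<Longrightarrow> D \<subseteq> D' \<Longrightarrow> blue.is_matching D' ps"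
  by (auto simp: blue.is_matching_def)

text \<open>\<open>C\<close> bounds the ratio of \<open>card V\<close> to the slack
  \<open>w\<close>. All other constants depend on \<open>C\<close> only, so the slack may be any
  fixed small fraction of \<open>V\<close>.\<close>

lemma red_cycle_or_blue_fan:
  assumes "finite V" "card V \<le> C * w" "0 < C" "3 \<le> w" "w \<le> m"
    and w: "(12 * C + 30) * big_enough (2 * (12 * C + 30) * C) \<le> w"
    and V: "2 * m + 2 * m + 2 * w \<le> card V" "2 * m + 2 * n + 2 * w \<le> card V"
  shows "red.has_cycle V (2 * m) \<or> (\<exists>v\<in>V. \<exists>ps. blue.is_matching (blue.nbrs V v) ps \<and> n \<le> length ps)"
proof (rule ccontr)
  assume contr: "\<not> ?thesis"
  then have nocyc: "\<not> red.has_cycle V (2 * m)"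
    and nofan: "\<And>v ps. v \<in> V \<Longrightarrow> blue.is_matching (blue.nbrs V v) ps \<Longrightarrow> length ps < n"
    by (auto simp: not_le)
  \<comment> \<open>\<open>M * h \<le> w\<close> leaves room for all losses of order
    \<open>h\<close> and \<open>C * h\<close>. As \<open>w \<le> 2 * M * h\<close>, the choice of
    \<open>K\<close> gives \<open>card V \<le> K * h\<close>.\<close>
  define M where "M = 12 * C + 30"
  define K where "K = 2 * M * C"
  define h where "h = w div M"
  have M: "M > 0" by (simp add: M_def)
  have Mh: "M * h \<le> w" by (simp add: h_def)
  have bh: "big_enough K \<le> h"
    using w M unfolding h_def K_def M_def[symmetric] by (simp add: less_eq_div_iff_mult_less_eq mult.commute)
  have "K > 0" using assms(3) M by (simp add: K_def)
  have "1 \<le> big_enough K" by (simp add: big_enough_def)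
  then have h1: "1 \<le> h" using bh by linarith
  have "w \<le> M * h + M" using M unfolding h_def
    by (metis add_le_cancel_left div_mod_decomp mod_less_divisor mult.commute less_imp_le)
  also have "\<dots> \<le> M * h + M * h" using h1 by simp
  finally have "w \<le> 2 * M * h" by simp
  then have "C * w \<le> C * (2 * M * h)" by (rule mult_le_mono2)
  also have "\<dots> = K * h" by (simp add: K_def)
  finally have Kh: "card V \<le> K * h" using assms(2) by linarith
  have hw: "12 * (C * h) + 30 * h \<le> w" using Mh by (simp add: M_def algebra_simps)
  have red_deg: "m + w \<le> card (red.nbrs V v)" if v: "v \<in> V" for v
  proof -
    have "V \<subseteq> insert v (red.nbrs V v \<union> blue.nbrs V v)"
    proof
      fix u assume "u \<in> V"
      then show "u \<in> insert v (red.nbrs V v \<union> blue.nbrs V v)"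
        using red_or_blue[of v u] by (cases "u = v") (auto simp: red.nbrs_def blue.nbrs_def)
    qed
    then have "card V \<le> card (insert v (red.nbrs V v \<union> blue.nbrs V v))"
      using assms(1) by (intro card_mono) (auto simp: red.nbrs_def blue.nbrs_def)
    also have "\<dots> \<le> Suc (card (red.nbrs V v \<union> blue.nbrs V v))"
      using assms(1) by (simp add: card_insert_if red.finite_nbrs blue.finite_nbrs)
    also have "\<dots> \<le> Suc (card (red.nbrs V v) + card (blue.nbrs V v))"
      using card_Un_le[of "red.nbrs V v" "blue.nbrs V v"] by simp
    finally have c: "card V \<le> Suc (card (red.nbrs V v) + card (blue.nbrs V v))" .
    \<comment> \<open>The second alternative is weighed against the mean of the two lower bounds on
      \<open>card V\<close>, which is \<open>3 * m + n + 2 * w\<close>.\<close>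
    have "card (blue.nbrs V v) < 2 * n + m + 3 \<or> card (blue.nbrs V v) < 2 * m + n + 3"
    proof (rule ccontr)
      assume "\<not> ?thesis"
      then have "red.has_cycle (blue.nbrs V v) (2 * m)"
        using assms(1,4,5) nofan[OF v] by (intro blue_matching_or_red_cycle[of _ m n]) (auto simp: blue.nbrs_def)
      then show False using nocyc red.has_cycle_mono by (metis (no_types, lifting) blue.nbrs_def mem_Collect_eq subsetI)
    qed
    then show ?thesis using c V assms(4) by linarith
  qed
  have "V \<noteq> {}" using V assms(4) by auto
  have "\<exists>P. finite P \<and> red.separated P \<and> \<Union>P \<subseteq> V \<and> card (V - \<Union>P) \<le> C * (6 * h) \<and>
    (\<forall>A\<in>P. red.robust (6 * h) A \<and> (\<forall>v\<in>A. m + 5 * h \<le> card (red.nbrs A v)))"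
  proof (rule red.robust_decomposition[OF assms(1) \<open>V \<noteq> {}\<close> assms(2)])
    show "m + 5 * h + (C + 1) * (6 * h) \<le> card (red.nbrs V v)" if "v \<in> V" for v
      using red_deg[OF that] hw by (simp add: algebra_simps)
  qed (use assms(4,5) in auto)
  then obtain P where P0: "finite P \<and> red.separated P \<and> \<Union>P \<subseteq> V \<and> card (V - \<Union>P) \<le> C * (6 * h) \<and>
    (\<forall>A\<in>P. red.robust (6 * h) A \<and> (\<forall>v\<in>A. m + 5 * h \<le> card (red.nbrs A v)))"
    by (rule exE)
  then have P: "finite P" "red.separated P" "\<Union>P \<subseteq> V" "card (V - \<Union>P) \<le> C * (6 * h)"
    by simp_all
  have PA: "red.robust (6 * h) A" "\<And>v. v \<in> A \<Longrightarrow> m + 5 * h \<le> card (red.nbrs A v)" if "A \<in> P" for A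
  proof -
    have "\<forall>A\<in>P. red.robust (6 * h) A \<and> (\<forall>v\<in>A. m + 5 * h \<le> card (red.nbrs A v))"
      using P0 by (elim conjE)
    then have "red.robust (6 * h) A \<and> (\<forall>v\<in>A. m + 5 * h \<le> card (red.nbrs A v))"
      using that by (rule bspec)
    then show "red.robust (6 * h) A" "\<And>v. v \<in> A \<Longrightarrow> m + 5 * h \<le> card (red.nbrs A v)" by simp_all
  qed
  have fU: "finite (\<Union>P)" by (rule finite_subset[OF P(3) assms(1)])
  have "h \<le> m" using hw assms(5) by linarith
  have small: "card A \<le> 2 * m + 5 * h" if A: "A \<in> P" for A
  proof (rule ccontr)
    assume "\<not> ?thesis"
    then have big: "2 * m + 5 * h \<le> card A" by simp
    have AV: "A \<subseteq> V" using A P(3) by blast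
    then have fA: "finite A" using assms(1) finite_subset by blast
    have "card A \<le> K * h" using AV assms(1) Kh by (meson card_mono le_trans)
    then have "red.has_cycle A (2 * m)"
      using red.robust_even_cycle[OF fA _ \<open>K > 0\<close> bh PA(1)[OF A] \<open>h \<le> m\<close> PA(2)[OF A] big] by blast
    then show False using nocyc red.has_cycle_mono AV by blast
  qed
  have "card V - card (V - \<Union>P) = card (\<Union>P)"
    using P(3) assms(1) fU by (metis card_Diff_subset card_mono diff_diff_cancel)
  then have cU: "card V \<le> card (\<Union>P) + 6 * (C * h)" using P(4) by simp
  obtain x where x: "x = C * h" by simp
  have "\<exists>v\<in>\<Union>P. \<exists>ps. blue.is_matching (blue.nbrs (\<Union>P) v) ps \<and> n \<le> length ps"
  proof (rule blue_fan_in_separated[OF P(1,2) fU small])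
    show "2 * m + 5 * h + 2 * n \<le> card (\<Union>P)"
      using cU V(2) hw unfolding x[symmetric] by linarith
    have "10 * h + 6 * x < 2 * w" using hw assms(4) unfolding x[symmetric] by simp
    then show "2 * (2 * m + 5 * h) < card (\<Union>P)"
      using cU V(1) unfolding x[symmetric] by simp
  qed
  then obtain v ps where "v \<in> \<Union>P" "blue.is_matching (blue.nbrs (\<Union>P) v) ps" "n \<le> length ps" by blast
  moreover have "blue.nbrs (\<Union>P) v \<subseteq> blue.nbrs V v" using P(3) by (rule blue.nbrs_mono)
  ultimately have "v \<in> V" "blue.is_matching (blue.nbrs V v) ps" "\<not> length ps < n"
    using P(3) is_matching_mono by auto
  then show False using nofan by blast
qed

end

section \<open>The Ramsey numbers\<close>

lemma flat_nth:
  "i < length ps \<Longrightarrow> flat ps ! (2 * i) = fst (ps ! i) \<and> flat ps ! Suc (2 * i) = snd (ps ! i)"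
proof (induction ps arbitrary: i)
  case (Cons a ps)
  then show ?case by (cases a; cases i) auto
qed simp

text \<open>A colouring also assigns a colour to singletons; \<open>u \<noteq> v\<close> makes the
  relation irreflexive, as \<open>adjacency\<close> demands.\<close>

definition coloured :: "(nat set \<Rightarrow> colour) \<Rightarrow> colour \<Rightarrow> nat \<Rightarrow> nat \<Rightarrow> bool" where
  "coloured \<kappa> c u v \<longleftrightarrow> u \<noteq> v \<and> \<kappa> {u, v} = c"

lemma two_colours_coloured: "two_colours (coloured \<kappa> Red) (coloured \<kappa> Blue)"
proof
  show "coloured \<kappa> Red u v \<or> coloured \<kappa> Blue u v" if "u \<noteq> v" for u v
    using that by (cases "\<kappa> {u, v}") (auto simp: coloured_def)
qed (auto simp: coloured_def insert_commute)

lemma coloured_edge: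
  "coloured \<kappa> c u v \<Longrightarrow> u < N \<Longrightarrow> v < N \<Longrightarrow> {u, v} \<in> snd (colour_graph N \<kappa> c)"
  by (simp add: coloured_def colour_graph_def)

lemma contains_cycle:
  assumes "adjacency.has_cycle (coloured \<kappa> c) {..<N} l"
  shows "contains_copy (colour_graph N \<kappa> c) (cycle_graph l)"
proof -
  interpret adjacency "coloured \<kappa> c"
    by standard (auto simp: coloured_def insert_commute)
  obtain p where p: "p \<noteq> []" "distinct p" "set p \<subseteq> {..<N}" "successively (coloured \<kappa> c) p" "length p = l"
    "coloured \<kappa> c (last p) (hd p)"
    using assms unfolding has_cycle_def is_path_def by blast
  have lt: "p ! i < N" if "i < l" for i using p(3,5) that nth_mem by fastforce
  have e: "{p ! i, p ! (Suc i mod l)} \<in> snd (colour_graph N \<kappa> c)" if "i < l" for i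
  proof (cases "Suc i < l")
    case True
    then show ?thesis using successively_nth[OF p(4)] p(5) lt by (auto intro: coloured_edge)
  next
    case False
    then have "Suc i = l" using that by simp
    then have "p ! i = last p" "p ! (Suc i mod l) = hd p"
      using p(1,5) by (auto simp: last_conv_nth hd_conv_nth)
    then show ?thesis using p(6) lt[OF that] lt[of 0] that p(1) coloured_edge[OF p(6)]
      by (simp add: hd_conv_nth)
  qed
  have "inj_on (\<lambda>i. p ! i) {..<l}" using p(2,5) by (simp add: inj_on_nth)
  then show ?thesis
    unfolding contains_copy_def cycle_graph_def fst_conv snd_conv
    using lt e by (intro exI[of _ "\<lambda>i. p ! i"]) (auto simp: colour_graph_def)
qed

lemma contains_fan:
  assumes "v < N" "adjacency.is_matching (coloured \<kappa> c) (adjacency.nbrs (coloured \<kappa> c) {..<N} v) ps" "n \<le> length ps"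
  shows "contains_copy (colour_graph N \<kappa> c) (fan_graph n)"
proof -
  interpret adjacency "coloured \<kappa> c"
    by standard (auto simp: coloured_def insert_commute)
  define xs where "xs = flat ps"
  have xs: "distinct xs" "set xs \<subseteq> nbrs {..<N} v" "2 * n \<le> length xs"
    using assms(2,3) by (auto simp: is_matching_def xs_def length_flat)
  have xv: "xs ! j < N" "coloured \<kappa> c v (xs ! j)" if "j < 2 * n" for j
  proof -
    have "xs ! j \<in> nbrs {..<N} v" using xs(2,3) that by (intro subsetD[OF xs(2)] nth_mem) simp
    then show "xs ! j < N" "coloured \<kappa> c v (xs ! j)" by (simp_all add: nbrs_def)
  qed
  \<comment> \<open>With the shift by one, the rim edge \<open>{2 * i - 1, 2 * i}\<close> goes to
    the pair \<open>ps ! (i - 1)\<close>.\<close>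
  define f where "f = (\<lambda>j. if j = 0 then v else xs ! (j - 1))"
  have inj: "inj_on f {0..2 * n}"
  proof (rule inj_onI)
    fix i j assume ij: "i \<in> {0..2 * n}" "j \<in> {0..2 * n}" "f i = f j"
    have ne: "v \<noteq> xs ! (k - 1)" if "k \<in> {0..2 * n}" "k \<noteq> 0" for k
      using xv(2)[of "k - 1"] that irrefl[of v] by force
    show "i = j"
    proof (cases "i = 0 \<or> j = 0")
      case True
      then show ?thesis using ij ne[of i] ne[of j] by (auto simp: f_def split: if_splits)
    next
      case False
      then have "i - 1 = j - 1" using ij xs(1,3) by (auto simp: f_def nth_eq_iff_index_eq)
      then show ?thesis using False by auto
    qed
  qed
  have ran: "f j < N" if "j \<in> {0..2 * n}" for j
    using that xv(1)[of "j - 1"] assms(1) by (auto simp: f_def)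
  have e1: "f ` {0, j} \<in> snd (colour_graph N \<kappa> c)" if "j \<in> {1..2 * n}" for j
    using that xv[of "j - 1"] assms(1) coloured_edge[of \<kappa> c v "xs ! (j - 1)" N]
    by (auto simp: f_def insert_commute)
  have e2: "f ` {2 * i - 1, 2 * i} \<in> snd (colour_graph N \<kappa> c)" if i: "i \<in> {1..n}" for i
  proof -
    obtain k where k: "i = Suc k" "k < n" using i by (cases i) auto
    have "ps ! k \<in> set ps" using k assms(3) by simp
    then have "coloured \<kappa> c (fst (ps ! k)) (snd (ps ! k))"
      using assms(2) by (auto simp: is_matching_def)
    then have "coloured \<kappa> c (xs ! (2 * k)) (xs ! Suc (2 * k))"
      using flat_nth[of k ps] k assms(3) by (simp add: xs_def)
    then have "{xs ! (2 * k), xs ! Suc (2 * k)} \<in> snd (colour_graph N \<kappa> c)"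
      using xv(1)[of "2 * k"] xv(1)[of "Suc (2 * k)"] k by (intro coloured_edge) auto
    then show ?thesis by (simp add: f_def k)
  qed
  show ?thesis
    unfolding contains_copy_def fan_graph_def fst_conv snd_conv
  proof (intro exI[of _ f] conjI ballI)
    show "f ` {0..2 * n} \<subseteq> fst (colour_graph N \<kappa> c)" using ran by (auto simp: colour_graph_def)
    fix e assume "e \<in> {{0, j} |j. j \<in> {1..2 * n}} \<union> {{2 * i - 1, 2 * i} |i. i \<in> {1..n}}"
    then show "f ` e \<in> snd (colour_graph N \<kappa> c)" using e1 e2 by blast
  qed (fact inj)
qed

section \<open>The upper bound for given parameters\<close>

lemma ramsey_upper:
  assumes "N \<le> C * w" "0 < C" "3 \<le> w" "w \<le> m"
    "(12 * C + 30) * big_enough (2 * (12 * C + 30) * C) \<le> w"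
    "2 * m + 2 * m + 2 * w \<le> N" "2 * m + 2 * n + 2 * w \<le> N"
  shows "ramsey_number (cycle_graph (2 * m)) (fan_graph n) \<le> N"
proof -
  have "ramsey_arrow N (cycle_graph (2 * m)) (fan_graph n)"
    unfolding ramsey_arrow_def
  proof
    fix \<kappa>
    interpret two_colours "coloured \<kappa> Red" "coloured \<kappa> Blue" by (rule two_colours_coloured)
    have "red.has_cycle {..<N} (2 * m) \<or>
      (\<exists>v\<in>{..<N}. \<exists>ps. blue.is_matching (blue.nbrs {..<N} v) ps \<and> n \<le> length ps)"
      using assms by (intro red_cycle_or_blue_fan[of _ C w]) auto
    then show "contains_copy (colour_graph N \<kappa> Red) (cycle_graph (2 * m)) \<or>
        contains_copy (colour_graph N \<kappa> Blue) (fan_graph n)"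
      using contains_cycle contains_fan by blast
  qed
  then show ?thesis unfolding ramsey_number_def using assms by (intro Least_le) auto
qed

section \<open>Colourings for the lower bounds\<close>

definition class_colouring :: "(nat \<Rightarrow> nat) \<Rightarrow> nat set \<Rightarrow> colour" where
  "class_colouring cl e = (if \<forall>u\<in>e. \<forall>v\<in>e. cl u = cl v then Red else Blue)"

text \<open>Red edges stay inside the classes, so a red cycle would fit into one class of fewer than
  \<open>2 * m\<close> vertices. In a blue fan every rim edge joins the two classes other than that
  of the centre, so the class \<open>c\<close> would contain \<open>n\<close> of its
  vertices.\<close>

lemma not_arrow_classes:
  fixes cl :: "nat \<Rightarrow> nat"
  assumes "1 \<le> m" and three: "\<And>u. cl u < 3"
    and small: "\<And>c. card {u. u < N \<and> cl u = c} < 2 * m"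
    and two: "\<And>u. u < N \<Longrightarrow> \<exists>c<3. c \<noteq> cl u \<and> card {u. u < N \<and> cl u = c} < n"
  shows "\<not> ramsey_arrow N (cycle_graph (2 * m)) (fan_graph n)"
proof
  assume "ramsey_arrow N (cycle_graph (2 * m)) (fan_graph n)"
  then consider "contains_copy (colour_graph N (class_colouring cl) Red) (cycle_graph (2 * m))"
    | "contains_copy (colour_graph N (class_colouring cl) Blue) (fan_graph n)"
    unfolding ramsey_arrow_def by blast
  then show False
  proof cases
    case 1
    then obtain f where f: "inj_on f {..<2 * m}" "f ` {..<2 * m} \<subseteq> {..<N}"
      and fe: "\<And>i. i < 2 * m \<Longrightarrow> f ` {i, Suc i mod (2 * m)} \<in> snd (colour_graph N (class_colouring cl) Red)"
      unfolding contains_copy_def cycle_graph_def fst_conv snd_conv colour_graph_def by blast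
    have step: "cl (f (Suc i)) = cl (f i)" if "Suc i < 2 * m" for i
      using fe[of i] that by (auto simp: colour_graph_def class_colouring_def split: if_splits)
    have "cl (f i) = cl (f 0)" if "i < 2 * m" for i
      using that by (induction i) (auto simp: step)
    then have "f ` {..<2 * m} \<subseteq> {u. u < N \<and> cl u = cl (f 0)}" using f(2) by auto
    then have "card (f ` {..<2 * m}) \<le> card {u. u < N \<and> cl u = cl (f 0)}" by (intro card_mono) auto
    then show False using small[of "cl (f 0)"] card_image[OF f(1)] by simp
  next
    case 2
    then obtain f where f0: "inj_on f (fst (fan_graph n))"
      "f ` fst (fan_graph n) \<subseteq> fst (colour_graph N (class_colouring cl) Blue)"
      "\<forall>e\<in>snd (fan_graph n). f ` e \<in> snd (colour_graph N (class_colouring cl) Blue)"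
      unfolding contains_copy_def by blast
    have f: "inj_on f {0..2 * n}" "f ` {0..2 * n} \<subseteq> {..<N}"
      using f0(1,2) by (simp_all add: fan_graph_def colour_graph_def)
    have fe: "f ` e \<in> snd (colour_graph N (class_colouring cl) Blue)"
      if "e \<in> {{0, j} |j. j \<in> {1..2 * n}} \<union> {{2 * i - 1, 2 * i} |i. i \<in> {1..n}}" for e
      using f0(3) that unfolding fan_graph_def snd_conv by (rule bspec)
    have blue: "cl (f i) \<noteq> cl (f j)" if "f ` {i, j} \<in> snd (colour_graph N (class_colouring cl) Blue)" for i j
      using that by (auto simp: colour_graph_def class_colouring_def split: if_splits)
    have spoke: "cl (f 0) \<noteq> cl (f j)" if "j \<in> {1..2 * n}" for j
      by (rule blue, rule fe) (use that in blast)
    have rim: "cl (f (2 * i - 1)) \<noteq> cl (f (2 * i))" if "i \<in> {1..n}" for i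
      by (rule blue, rule fe) (use that in blast)
    have "f 0 \<in> {..<N}" by (rule subsetD[OF f(2)]) simp
    then have "f 0 < N" by simp
    then obtain c where c: "c < 3" "c \<noteq> cl (f 0)" "card {u. u < N \<and> cl u = c} < n" using two by blast
    have pick: "cl (f (2 * i - 1)) = c \<or> cl (f (2 * i)) = c" if "i \<in> {1..n}" for i
    proof -
      have "2 * i - 1 \<in> {1..2 * n}" "2 * i \<in> {1..2 * n}" using that by auto
      then show ?thesis
        using spoke[of "2 * i - 1"] spoke[of "2 * i"] rim[OF that] c(1,2)
          three[of "f 0"] three[of "f (2 * i)"] three[of "f (2 * i - 1)"] by linarith
    qed
    define g where "g = (\<lambda>i. if cl (f (2 * i - 1)) = c then 2 * i - 1 else 2 * i)"
    have gr: "g ` {1..n} \<subseteq> {0..2 * n}" by (auto simp: g_def)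
    have "inj_on g {1..n}"
    proof (rule inj_onI)
      fix i j assume "i \<in> {1..n}" "j \<in> {1..n}" "g i = g j"
      then show "i = j" unfolding g_def by (auto split: if_splits)
    qed
    then have "inj_on (f \<circ> g) {1..n}" using f(1) gr by (meson comp_inj_on inj_on_subset)
    then have "card ((f \<circ> g) ` {1..n}) = card {1..n}" by (rule card_image)
    then have "n = card ((f \<circ> g) ` {1..n})" by simp
    also have "\<dots> \<le> card {u. u < N \<and> cl u = c}"
    proof (intro card_mono subsetI)
      fix u assume "u \<in> (f \<circ> g) ` {1..n}"
      then obtain i where i: "i \<in> {1..n}" "u = f (g i)" by auto
      then have "u < N" using gr f(2) by blast
      then show "u \<in> {u. u < N \<and> cl u = c}" using pick[OF i(1)] i(2) by (auto simp: g_def)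
    qed simp
    finally show False using c(3) by simp
  qed
qed

text \<open>The Ramsey number has the arrow property by \<open>ramsey_number_arrow\<close>, hence
  exceeds every \<open>N\<close> without it. Assuming failure at every \<open>N \<le> N0\<close>
  takes the place of monotonicity of the arrow.\<close>

lemma less_ramsey_number:
  assumes "1 \<le> m" "\<And>N. N \<le> N0 \<Longrightarrow> \<not> ramsey_arrow N (cycle_graph (2 * m)) (fan_graph n)"
  shows "N0 < ramsey_number (cycle_graph (2 * m)) (fan_graph n)"
proof -
  have "simple_graph (cycle_graph (2 * m))" using assms(1) by (intro simple_graph_cycle) simp
  then have "ramsey_arrow (ramsey_number (cycle_graph (2 * m)) (fan_graph n)) (cycle_graph (2 * m)) (fan_graph n)"
    using ramsey_number_arrow simple_graph_fan by blast
  then show ?thesis using assms(2) by (meson linorder_not_le)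
qed

lemma card_le_interval:
  assumes "\<And>u. u \<in> A \<Longrightarrow> a \<le> u \<and> u < a + (k :: nat)"
  shows "card A \<le> k"
proof -
  have "card A \<le> card {a..<a + k}" using assms by (intro card_mono) auto
  then show ?thesis by simp
qed

text \<open>Two red cliques of at most \<open>2 * m - 1\<close> vertices; class 2 is empty and
  serves as the small class that \<open>not_arrow_classes\<close> asks for.\<close>

lemma ramsey_lower_two_cliques:
  assumes "1 \<le> m" "1 \<le> n"
  shows "4 * m - 2 < ramsey_number (cycle_graph (2 * m)) (fan_graph n)"
proof (rule less_ramsey_number[OF assms(1)])
  fix N assume N: "N \<le> 4 * m - 2"
  let ?cl = "\<lambda>u. if u < 2 * m - 1 then 0 else 1 :: nat"
  show "\<not> ramsey_arrow N (cycle_graph (2 * m)) (fan_graph n)"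
  proof (rule not_arrow_classes[OF assms(1), of ?cl])
    fix c
    have "card {u. u < N \<and> ?cl u = c} \<le> 2 * m - 1"
      by (rule card_le_interval[of _ "if c = 0 then 0 else 2 * m - 1"]) (use N in \<open>auto split: if_splits\<close>)
    then show "card {u. u < N \<and> ?cl u = c} < 2 * m" using assms(1) by linarith
  next
    fix u
    have "{u. u < N \<and> ?cl u = 2} = {}" by auto
    then show "\<exists>c<3. c \<noteq> ?cl u \<and> card {u. u < N \<and> ?cl u = c} < n"
      using assms(2) by (intro exI[of _ 2]) simp
  qed simp
qed

text \<open>Red cliques of sizes \<open>2m - 1\<close>, \<open>n - 2\<close>, \<open>n - 2\<close>; sizes \<open>n - 1\<close> would fail for \<open>2m = n - 1\<close>,
  which occurs when \<open>a = 1/2\<close> and \<open>n\<close> is odd.\<close>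

lemma ramsey_lower_three_cliques:
  assumes "1 \<le> m" "2 \<le> n" "n \<le> 2 * m + 1"
  shows "2 * m - 1 + 2 * (n - 2) < ramsey_number (cycle_graph (2 * m)) (fan_graph n)"
proof (rule less_ramsey_number[OF assms(1)])
  fix N assume N: "N \<le> 2 * m - 1 + 2 * (n - 2)"
  let ?cl = "\<lambda>u. if u < 2 * m - 1 then 0 else if u < 2 * m - 1 + (n - 2) then 1 else 2 :: nat"
  have small: "card {u. u < N \<and> ?cl u = c} \<le> n - 2" if "c \<noteq> 0" for c
    by (rule card_le_interval[of _ "if c = 1 then 2 * m - 1 else 2 * m - 1 + (n - 2)"])
      (use N that in \<open>auto split: if_splits\<close>)
  show "\<not> ramsey_arrow N (cycle_graph (2 * m)) (fan_graph n)"
  proof (rule not_arrow_classes[OF assms(1), of ?cl])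
    fix c
    show "card {u. u < N \<and> ?cl u = c} < 2 * m"
    proof (cases "c = 0")
      case True
      have "card {u. u < N \<and> ?cl u = c} \<le> 2 * m - 1"
        by (rule card_le_interval[of _ 0]) (use True in \<open>auto split: if_splits\<close>)
      then show ?thesis using assms(1) by linarith
    next
      case False
      then show ?thesis using small[of c] assms by linarith
    qed
  next
    fix u
    \<comment> \<open>Classes 1 and 2 are both small, and at least one of them differs from the
      class of \<open>u\<close>.\<close>
    define c :: nat where "c = (if ?cl u = 1 then 2 else 1)"
    have "c < 3" "c \<noteq> 0" "c \<noteq> ?cl u" by (auto simp: c_def)
    moreover have "card {u. u < N \<and> ?cl u = c} < n" using small[OF \<open>c \<noteq> 0\<close>] assms(2) by linarith
    ultimately show "\<exists>c<3. c \<noteq> ?cl u \<and> card {u. u < N \<and> ?cl u = c} < n" by blast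
  qed simp
qed

text \<open>Both cases of the theorem in one formula; \<open>max a 1\<close> is the limit of
  \<open>max m n / n\<close>.\<close>

lemma ramsey_limit:
  fixes a :: real
  assumes "a \<ge> 1 / 2"
  shows "(\<lambda>n. real (ramsey_number (cycle_graph (2 * nat \<lfloor>a * real n\<rfloor>)) (fan_graph n)) / real n)
    \<longlonglongrightarrow> 2 * a + 2 * max a 1"
proof (rule LIMSEQ_I)
  fix r :: real assume "0 < r"
  define R where "R = (\<lambda>n. ramsey_number (cycle_graph (2 * nat \<lfloor>a * real n\<rfloor>)) (fan_graph n))"
  \<comment> \<open>The slack \<open>w\<close> is about \<open>e * n\<close>: the error
    \<open>2 * w\<close> is then at most \<open>r * n / 2\<close>, and \<open>e \<le> 1 / 8\<close>
    ensures \<open>w \<le> m\<close>.\<close>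
  define e where "e = min (r / 4) (1 / 8)"
  have e: "0 < e" "e \<le> r / 4" "e \<le> 1 / 8" using \<open>0 < r\<close> by (auto simp: e_def)
  \<comment> \<open>Chosen so that \<open>N \<le> (4 * a + 4) * n\<close> and
    \<open>w \<ge> e * n / 2\<close> give \<open>N \<le> C * w\<close>.\<close>
  define C where "C = nat \<lceil>2 * (4 * a + 4) / e\<rceil>"
  have C: "2 * (4 * a + 4) / e \<le> real C" unfolding C_def by linarith
  have "0 < 2 * (4 * a + 4) / e" using e assms by simp
  then have "0 < C" using C by (metis less_le_trans of_nat_0_less_iff)
  define W where "W = max 3 ((12 * C + 30) * big_enough (2 * (12 * C + 30) * C))"
  \<comment> \<open>From here on \<open>e * n \<ge> W + 10\<close>, so that
    \<open>w \<ge> W\<close>, and \<open>r * n > 8\<close> absorbs the additive constants of the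
    lower bounds.\<close>
  define n0 where "n0 = nat \<lceil>(real W + 10) / e\<rceil> + nat \<lceil>8 / r\<rceil> + 10"
  have "\<bar>real (R n) / real n - (2 * a + 2 * max a 1)\<bar> < r" if n: "n0 \<le> n" for n
  proof -
    define m where "m = nat \<lfloor>a * real n\<rfloor>"
    define w where "w = nat \<lfloor>e * real n\<rfloor>"
    have "(real W + 10) / e \<le> real n" "8 / r < real n" "10 \<le> n"
      using n unfolding n0_def by linarith+
    then have en: "real W + 10 \<le> e * real n" and rn: "8 < r * real n"
      using e \<open>0 < r\<close> by (simp_all add: field_simps)
    have n10: "10 \<le> real n" using \<open>10 \<le> n\<close> by simp
    have an: "real n / 2 \<le> a * real n" using mult_right_mono[OF assms, of "real n"] by simp
    have en8: "e * real n \<le> real n / 8" using mult_right_mono[OF e(3), of "real n"] by simp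
    have m: "real m \<le> a * real n" "a * real n < real m + 1"
      using an unfolding m_def by linarith+
    have w: "real w \<le> e * real n" "e * real n < real w + 1"
      using en unfolding w_def by linarith+
    have "W \<le> w" using w en by linarith
    have "w \<le> m" using w m an en8 n10 by linarith
    have m1: "1 \<le> m" using m an n10 by linarith
    define N where "N = 2 * m + 2 * max m n + 2 * w"
    have "real N \<le> (4 * a + 4) * real n"
    proof -
      have "real (max m n) \<le> a * real n + real n" using m(1) by linarith
      then have "real N \<le> 2 * (a * real n) + 2 * (a * real n + real n) + 2 * (real n / 8)"
        using m w en8 unfolding N_def by simp
      also have "\<dots> \<le> (4 * a + 4) * real n" by (simp add: algebra_simps)
      finally show ?thesis .
    qed
    also have "\<dots> = (2 * (4 * a + 4) / e) * (e * real n / 2)" using e by (simp add: field_simps)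
    also have "\<dots> \<le> real C * real w"
    proof (rule mult_mono[OF C])
      show "e * real n / 2 \<le> real w" using w en by linarith
    qed (use e in auto)
    finally have "N \<le> C * w" by (simp flip: of_nat_mult)
    then have "R n \<le> N"
      unfolding R_def m_def[symmetric] using \<open>0 < C\<close> \<open>W \<le> w\<close> \<open>w \<le> m\<close>
      by (intro ramsey_upper[of _ C w]) (auto simp: W_def N_def)
    have maxb: "real (max m n) \<le> max a 1 * real n"
      using m(1) mult_right_mono[of a "max a 1" "real n"] mult_right_mono[of 1 "max a 1" "real n"] by auto
    have "real (R n) \<le> 2 * real m + 2 * real (max m n) + 2 * real w"
      using \<open>R n \<le> N\<close> unfolding N_def by linarith
    then have "real (R n) \<le> (2 * a + 2 * max a 1) * real n + 2 * (e * real n)"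
      using m maxb w by (simp add: algebra_simps)
    also have "\<dots> < (2 * a + 2 * max a 1 + r) * real n"
    proof -
      have "2 * (e * real n) < r * real n" using e \<open>0 < r\<close> n10 by (simp add: mult.assoc[symmetric])
      then show ?thesis by (simp add: algebra_simps)
    qed
    finally have up: "real (R n) / real n < 2 * a + 2 * max a 1 + r"
      using n10 by (simp add: divide_less_eq)
    have "4 * m - 2 < R n"
      unfolding R_def m_def[symmetric] using m1 \<open>10 \<le> n\<close> by (intro ramsey_lower_two_cliques) auto
    then have l1: "4 * real m - 2 < real (R n)" by linarith
    have "n \<le> 2 * m + 1"
    proof -
      have "real n < 2 * real m + 2" using m an by linarith
      then show ?thesis by linarith
    qed
    then have "2 * m - 1 + 2 * (n - 2) < R n"
      unfolding R_def m_def[symmetric] using m1 \<open>10 \<le> n\<close> by (intro ramsey_lower_three_cliques) auto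
    then have l2: "2 * real m + 2 * real n - 5 < real (R n)" using m1 \<open>10 \<le> n\<close> by linarith
    \<comment> \<open>Three cliques serve for \<open>a \<le> 1\<close> and two for
      \<open>a > 1\<close>; rounding in \<open>m\<close> and the additive constants together cost
      less than 8.\<close>
    have "(2 * a + 2 * max a 1) * real n - 8 < real (R n)"
    proof (cases "a \<le> 1")
      case True
      then show ?thesis using l2 m by (simp add: algebra_simps max_def)
    next
      case False
      then show ?thesis using l1 m by (simp add: algebra_simps max_def)
    qed
    then have "(2 * a + 2 * max a 1 - r) * real n < real (R n)"
      using rn by (simp add: algebra_simps)
    then have "2 * a + 2 * max a 1 - r < real (R n) / real n"
      using n10 by (simp add: less_divide_eq)
    then show ?thesis using up by linarith
  qed
  then show "\<exists>no. \<forall>n\<ge>no. norm (real (ramsey_number (cycle_graph (2 * nat \<lfloor>a * real n\<rfloor>)) (fan_graph n)) / real n -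
      (2 * a + 2 * max a 1)) < r"
    unfolding R_def by auto
qed

theorem theorem1p1:
  fixes a :: real
  assumes "a \<ge> 1 / 2"
  shows "(1 / 2 \<le> a \<and> a < 1 \<longrightarrow>
           (\<lambda>n. real (ramsey_number (cycle_graph (2 * nat \<lfloor>a * real n\<rfloor>)) (fan_graph n)) / real n)
             \<longlonglongrightarrow> 2 + 2 * a) \<and>
         (a \<ge> 1 \<longrightarrow>
           (\<lambda>n. real (ramsey_number (cycle_graph (2 * nat \<lfloor>a * real n\<rfloor>)) (fan_graph n)) / real n)
             \<longlonglongrightarrow> 4 * a)"
proof (intro conjI impI)
  assume "1 / 2 \<le> a \<and> a < 1"
  then have "2 + 2 * a = 2 * a + 2 * max a 1" by simp
  then show "(\<lambda>n. real (ramsey_number (cycle_graph (2 * nat \<lfloor>a * real n\<rfloor>)) (fan_graph n)) / real n)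
    \<longlonglongrightarrow> 2 + 2 * a"
    using ramsey_limit[OF assms] by (simp only:)
next
  assume "a \<ge> 1"
  then have "4 * a = 2 * a + 2 * max a 1" by simp
  then show "(\<lambda>n. real (ramsey_number (cycle_graph (2 * nat \<lfloor>a * real n\<rfloor>)) (fan_graph n)) / real n)
    \<longlonglongrightarrow> 4 * a"
    using ramsey_limit[OF assms] by (simp only:)
qed

end
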